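(* Let $p$ be an odd prime with $p = a_4^2 + b_4^2$, where $a_4, b_4 \in \mathbb{Z}$ and $a_4 \equiv -\mu \pmod 4$, with $\mu \in \{1,-1\}$ determined by $\mu \equiv 2^{(p-1)/2} \pmod p$. Let $\left(\frac{\cdot}{p}\right)$ be the quadratic character (Legendre symbol) modulo $p$, i.e. the multiplicative character of $\mathbf{F}_p$ of order $2$. Then $$\sum_{x=0}^{p-1} \left(\frac{x}{p}\right) e^{i2\pi x^2/p} = \pm\sqrt{2\mu\left(p + a_4\sqrt{p}\right)},$$ that is, for one of the two choices of the sign, the equality holds (the sum is one of the two complex square roots of $2\mu(p+a_4\sqrt{p})$).
   Context: The Legendre symbol satisfies $\left(\frac{0}{p}\right)=0$. The symbol $\sqrt{p}$ denotes the positive square root. The quantity under the outer square root is a real number, possibly negative, so the outer square root is taken in $\mathbb{C}$. The sign $\pm$ is left undetermined: the assertion is that the equality holds for one of the two signs (depending on $p$). *)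

theory Defs
  imports Complex_Main "HOL-Number_Theory.Number_Theory"
begin

end

theory Submission
  imports Defs "HOL-Number_Theory.Modular_Inverse" "HOL-Analysis.Convex"
begin

text \<open>
  Write \<open>\<chi>\<close> for the Legendre symbol modulo \<open>p\<close> and \<open>e k\<close> for \<open>exp (2 \<pi> i k / p)\<close>. A sum of two squares that is an odd
  prime is \<open>1\<close> modulo \<open>4\<close>, so \<open>-1\<close> is a square modulo \<open>p\<close>. It suffices to compute the square of
  \<open>S = \<Sum>x. \<chi> x * e (x\<^sup>2)\<close>, since the two square roots of a complex number differ by a sign.

  Substituting \<open>y = x t\<close> in the double sum for \<open>S\<^sup>2\<close> turns the inner sum into a quadratic Gauss sum with parameter
  \<open>1 + t\<^sup>2\<close>. Such a sum equals \<open>\<chi> (1 + t\<^sup>2) G\<close> with \<open>G = \<Sum>x. e (x\<^sup>2)\<close>, except that it equals \<open>p\<close> when \<open>t\<^sup>2 = -1\<close>. Both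
  square roots of \<open>-1\<close> have the symbol \<open>\<chi> 2 = \<mu>\<close>, because \<open>(1 + i)\<^sup>2 = 2 i\<close>. Therefore
  \<open>S\<^sup>2 = 2 \<mu> p + G J\<close> with the Jacobsthal sum \<open>J = \<Sum>t. \<chi> (t (t\<^sup>2 + 1))\<close> (lemma \<open>twisted_sum_squared\<close>). Two facts
  remain.

  The first is \<open>G = sqrt p\<close> with the positive sign (\<open>gauss_sum_value\<close>). That \<open>G\<^sup>2 = p\<close> is a short
  computation, so only \<open>G > - sqrt p\<close> has to be shown. After a reordering of the sum, the first terms have
  nonnegative real parts and the rest is small by summation by parts.

  The second is \<open>J = 2 \<mu> a\<^sub>4\<close> (\<open>jacobsthal_1_eq\<close>). By Jacobsthal's theorem the halves of two such sums, one for the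
  residue \<open>1\<close> and one for a nonresidue, have squares adding up to \<open>p\<close> (\<open>jacobsthal_two_squares\<close>). The symmetries
  \<open>t \<mapsto> - t\<close> and \<open>t \<mapsto> 1 / t\<close> of the summand give \<open>J = -2\<close> modulo \<open>8\<close> (\<open>jacobsthal_1_mod_8\<close>), so \<open>J / 2\<close> is odd and
  \<open>-1\<close> modulo \<open>4\<close>. As the odd member of a representation of a prime as a sum of two squares is unique up to sign,
  \<open>J / 2 = \<plusminus> a\<^sub>4\<close>, and the congruences modulo \<open>4\<close> fix the sign.
\<close>

section \<open>Inequalities and counting\<close>

text \<open>
  On \<open>[0, \<pi>/2]\<close> the concave sine lies above its chord.
\<close>

lemma sin_ge_linear:
  fixes x :: real
  assumes "0 \<le> x" "x \<le> pi / 2"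
  shows "2 / pi * x \<le> sin x"
proof -
  have "concave_on {0..pi} (sin :: real \<Rightarrow> real)"
    by (rule f''_le0_imp_concave[where f' = cos and f'' = "\<lambda>x. - sin x"])
       (auto intro!: derivative_eq_intros sin_ge_zero)
  then have "sin ((1 - 2 / pi * x) *\<^sub>R 0 + (2 / pi * x) *\<^sub>R (pi / 2))
      \<ge> (1 - 2 / pi * x) * sin 0 + (2 / pi * x) * sin (pi / 2)"
    by (rule concave_onD) (use assms in \<open>auto simp: field_simps\<close>)
  then show ?thesis by simp
qed

text \<open>
  Summation by parts. All but the two boundary terms become \<open>B r * (1 / s r - 1 / s (r + 1))\<close>, and these
  weights are nonnegative and telescope. Subtracting the upper boundary term on the left leaves the gain
  \<open>- 2 / s n\<close> on the right; the sign of the Gauss sum depends on this gain.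
\<close>

lemma norm_sum_differences_over_increasing:
  fixes B :: "nat \<Rightarrow> complex" and s :: "nat \<Rightarrow> real"
  assumes "m < n" and B: "\<And>r. norm (B r) \<le> 2"
    and pos: "\<And>r. m < r \<Longrightarrow> r \<le> n \<Longrightarrow> 0 < s r"
    and mono: "\<And>r. m < r \<Longrightarrow> r < n \<Longrightarrow> s r \<le> s (Suc r)"
  shows "norm ((\<Sum>r = Suc m..n. (B r - B (r - 1)) / of_real (s r)) - B n / of_real (s n))
    \<le> 4 / s (Suc m) - 2 / s n"
  using assms(1) pos mono
proof (induction n)
  case (Suc n)
  show ?case
  proof (cases "m = n")
    case True
    have "0 < s (Suc n)" using Suc.prems True by simp
    then have "norm (B n / of_real (s (Suc n))) \<le> 2 / s (Suc n)"
      using B[of n] by (simp add: norm_divide divide_right_mono)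
    then show ?thesis
      using True by (simp add: diff_divide_distrib)
  next
    case False
    then have less: "m < n" using Suc.prems(1) by simp
    define D where "D = (\<Sum>r = Suc m..n. (B r - B (r - 1)) / of_real (s r)) - B n / of_real (s n)"
    have IH: "norm D \<le> 4 / s (Suc m) - 2 / s n"
      unfolding D_def using less Suc.prems by (intro Suc.IH) auto
    have s: "0 < s n" "s n \<le> s (Suc n)" "0 < s (Suc n)" using less Suc.prems by auto
    have "(\<Sum>r = Suc m..Suc n. (B r - B (r - 1)) / of_real (s r)) - B (Suc n) / of_real (s (Suc n))
        = D + B n * of_real (1 / s n - 1 / s (Suc n))"
      using less by (simp add: D_def diff_divide_distrib algebra_simps)
    also have "norm \<dots> \<le> norm D + norm (B n) * \<bar>1 / s n - 1 / s (Suc n)\<bar>"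
      by (metis norm_mult norm_of_real norm_triangle_ineq)
    also have "\<bar>1 / s n - 1 / s (Suc n)\<bar> = 1 / s n - 1 / s (Suc n)"
      using s by (simp add: frac_le)
    also have "norm (B n) * (1 / s n - 1 / s (Suc n)) \<le> 2 * (1 / s n - 1 / s (Suc n))"
      using s B[of n] by (intro mult_right_mono) (auto simp: frac_le)
    finally show ?thesis using IH by (simp add: algebra_simps)
  qed
qed simp

text \<open>
  The alternating sum of the first \<open>m\<close> squares is, up to sign, the triangular number \<open>m (m + 1) / 2\<close>.
  The summands are the lower bounds that the sine and the cosine satisfy along the sum studied below.
\<close>

lemma alternating_sum_of_squares:
  "(\<Sum>r = 1..m. if even r then 1 - (real r)\<^sup>2 / c else (real r)\<^sup>2 / c)
    = real (m div 2) - (- 1) ^ m * (real m * (real m + 1) / (2 * c))"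
proof (induction m)
  case (Suc m)
  let ?t = "\<lambda>r. if even r then 1 - (real r)\<^sup>2 / c else (real r)\<^sup>2 / c"
  have "(\<Sum>r = 1..Suc m. ?t r) = real (m div 2) - (- 1) ^ m * (real m * (real m + 1) / (2 * c)) + ?t (Suc m)"
    using Suc.IH by simp
  also have "\<dots> = real (Suc m div 2) - (- 1) ^ Suc m * (real (Suc m) * (real (Suc m) + 1) / (2 * c))"
    by (cases "c = 0"; cases "even m")
       (auto elim!: evenE oddE simp: field_simps power2_eq_square)
  finally show ?case .
qed simp

text \<open>
  Every orbit of the group generated by \<open>f\<close> and \<open>g\<close> has exactly four elements.
\<close>

lemma card_dvd_4_if_free_klein_four_action:
  assumes "finite U"
    and closed: "\<And>x. x \<in> U \<Longrightarrow> f x \<in> U" "\<And>x. x \<in> U \<Longrightarrow> g x \<in> U"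
    and invol: "\<And>x. x \<in> U \<Longrightarrow> f (f x) = x" "\<And>x. x \<in> U \<Longrightarrow> g (g x) = x"
    and commute: "\<And>x. x \<in> U \<Longrightarrow> f (g x) = g (f x)"
    and free: "\<And>x. x \<in> U \<Longrightarrow> f x \<noteq> x" "\<And>x. x \<in> U \<Longrightarrow> g x \<noteq> x" "\<And>x. x \<in> U \<Longrightarrow> f (g x) \<noteq> x"
  shows "4 dvd card U"
proof -
  define orb where "orb x = {x, f x, g x, f (g x)}" for x
  have sub: "orb x \<subseteq> U" if "x \<in> U" for x
    using that closed by (auto simp: orb_def)
  have card_orb: "card (orb x) = 4" if "x \<in> U" for x
  proof -
    have "f x \<noteq> g x" using that free(3) invol(1) by metis
    moreover have "f x \<noteq> f (g x)" using that free(2) closed invol(1) by metis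
    moreover have "g x \<noteq> f (g x)" using that free(1)[of "g x"] closed by metis
    moreover have "x \<noteq> f x" "x \<noteq> g x" "x \<noteq> f (g x)" using that free by metis+
    ultimately show ?thesis unfolding orb_def by simp
  qed
  have orb_eq: "orb y = orb x" if "x \<in> U" "y \<in> orb x" for x y
    using that closed invol commute unfolding orb_def by (elim insertE emptyE) auto
  have "4 * card (orb ` U) = card (\<Union> (orb ` U))"
  proof (rule card_partition)
    show "finite (orb ` U)" "finite (\<Union> (orb ` U))"
      using assms(1) by (auto simp: orb_def)
    show "card c = 4" if "c \<in> orb ` U" for c
      using that card_orb by auto
    show "c1 \<inter> c2 = {}" if "c1 \<in> orb ` U" "c2 \<in> orb ` U" "c1 \<noteq> c2" for c1 c2
      using that orb_eq by blast
  qed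
  moreover have "\<Union> (orb ` U) = U"
    using sub by (auto simp: orb_def)
  ultimately show ?thesis by (metis dvd_triv_left)
qed

text \<open>
  If \<open>q\<close> divides one of the factors of \<open>(a d - c b) (a d + c b) = q (a\<^sup>2 - c\<^sup>2)\<close>, then
  \<open>(a c + b d)\<^sup>2 + (a d - c b)\<^sup>2 = q\<^sup>2\<close> forces this factor to be \<open>0\<close> or \<open>\<plusminus> q\<close>. The second case would
  make the odd number \<open>a c + b d\<close> vanish.
\<close>

lemma prime_two_squares_unique:
  fixes a b c d q :: int
  assumes q: "prime q" "q = a\<^sup>2 + b\<^sup>2" "q = c\<^sup>2 + d\<^sup>2" and odd: "odd a" "odd c" "odd q"
  shows "a\<^sup>2 = c\<^sup>2"
proof -
  have main: "a\<^sup>2 = c\<^sup>2" if d: "q = c\<^sup>2 + d\<^sup>2" and dvd: "q dvd a * d - c * b" for d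
  proof -
    \<comment> \<open>An odd sum of two squares has exactly one odd member; hence \<open>a c + b d\<close> is odd.\<close>
    have even: "even b" "even d" using odd(3)[unfolded q(2)] odd(3)[unfolded d] odd(1,2) by simp_all
    have sq: "(a * c + b * d)\<^sup>2 + (a * d - c * b)\<^sup>2 = q\<^sup>2"
    proof -
      have "(a * c + b * d)\<^sup>2 + (a * d - c * b)\<^sup>2 = (a\<^sup>2 + b\<^sup>2) * (c\<^sup>2 + d\<^sup>2)"
        by (simp add: power2_eq_square algebra_simps)
      then show ?thesis using q(2) d by (simp add: power2_eq_square)
    qed
    have "a * c + b * d \<noteq> 0"
    proof
      assume "a * c + b * d = 0"
      then have "even (a * c + b * d)" by simp
      then show False using odd even by simp
    qed
    then have "(a * d - c * b)\<^sup>2 < q\<^sup>2" using sq zero_less_power2[of "a * c + b * d"] by linarith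
    then have less: "\<bar>a * d - c * b\<bar> < q"
      using prime_gt_0_int[OF q(1)] by (intro power2_less_imp_less[of "\<bar>a * d - c * b\<bar>" q]) simp_all
    have zero: "a * d - c * b = 0"
    proof (rule ccontr)
      assume "a * d - c * b \<noteq> 0"
      then have "q \<le> \<bar>a * d - c * b\<bar>" using dvd by (intro zdvd_imp_le) simp_all
      then show False using less by simp
    qed
    have "q * (a\<^sup>2 - c\<^sup>2) = a\<^sup>2 * q - c\<^sup>2 * q"
      by (simp add: algebra_simps)
    also have "\<dots> = a\<^sup>2 * (c\<^sup>2 + d\<^sup>2) - c\<^sup>2 * (a\<^sup>2 + b\<^sup>2)"
      by (simp only: q(2)[symmetric] d[symmetric])
    also have "\<dots> = (a * d)\<^sup>2 - (c * b)\<^sup>2"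
      by (simp add: power2_eq_square algebra_simps)
    also have "\<dots> = 0" using zero by simp
    finally show ?thesis using prime_gt_0_int[OF q(1)] by simp
  qed
  have "(a * d - c * b) * (a * d - c * (- b)) = a\<^sup>2 * (c\<^sup>2 + d\<^sup>2) - c\<^sup>2 * (a\<^sup>2 + b\<^sup>2)"
    by (simp add: power2_eq_square algebra_simps)
  also have "\<dots> = a\<^sup>2 * q - c\<^sup>2 * q"
    by (simp only: q(2,3)[symmetric])
  also have "\<dots> = q * (a\<^sup>2 - c\<^sup>2)"
    by (simp add: algebra_simps)
  finally have "q dvd (a * d - c * b) * (a * d - c * (- b))" by simp
  then have "q dvd a * d - c * b \<or> q dvd a * d - c * (- b)"
    using q(1) prime_dvd_mult_iff by blast
  then show ?thesis
  proof
    assume "q dvd a * d - c * (- b)"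
    moreover have "a * (- d) - c * b = - (a * d - c * (- b))" by simp
    ultimately have "q dvd a * (- d) - c * b" by (metis dvd_minus_iff)
    then show ?thesis using main[of "- d"] q(3) by simp
  qed (use main q(3) in blast)
qed

section \<open>Functions of residues modulo p\<close>

locale prime_1_mod_4 =
  fixes p :: nat
  assumes prime_p: "prime p" and p_mod_4: "p mod 4 = 1"
begin

abbreviation \<F> :: "int set" where "\<F> \<equiv> {0..<int p}"

abbreviation \<chi> :: "int \<Rightarrow> int" where "\<chi> a \<equiv> Legendre a (int p)"

definition class_fun :: "(int \<Rightarrow> 'a) \<Rightarrow> bool" where
  "class_fun f \<longleftrightarrow> (\<forall>x y. [x = y] (mod int p) \<longrightarrow> f x = f y)"

definition e :: "int \<Rightarrow> complex" where
  "e k = cis (2 * pi * of_int k / real p)"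

lemma p_ge_5: "p \<ge> 5"
proof -
  have "p \<noteq> 0" "p \<noteq> 1" "p \<noteq> 2" "p \<noteq> 3" "p \<noteq> 4"
    using prime_p p_mod_4 by auto
  then show ?thesis by linarith
qed

lemma p_pos: "int p > 0" "p > 0" "real p > 0"
  using p_ge_5 by auto

lemma prime_int_p: "prime (int p)"
  using prime_p by simp

lemma dvd_mult_p_iff: "int p dvd a * b \<longleftrightarrow> int p dvd a \<or> int p dvd b"
  using prime_int_p by (rule prime_dvd_mult_iff)

lemma dvd_power2_p_iff: "int p dvd a\<^sup>2 \<longleftrightarrow> int p dvd a"
  by (simp add: power2_eq_square dvd_mult_p_iff)

lemma coprime_p_iff: "coprime a (int p) \<longleftrightarrow> \<not> int p dvd a"
  by (metis coprime_commute prime_int_p prime_imp_coprime coprime_absorb_left not_prime_unit)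

lemma not_dvd_2: "\<not> int p dvd 2"
  using p_ge_5 by (auto dest: zdvd_imp_le)

lemma not_dvd_1: "\<not> int p dvd 1"
  using p_ge_5 by auto

lemma cong_residues_imp_eq: "x \<in> \<F> \<Longrightarrow> y \<in> \<F> \<Longrightarrow> [x = y] (mod int p) \<Longrightarrow> x = y"
  by (auto simp: cong_def)

lemma dvd_residue_iff: "x \<in> \<F> \<Longrightarrow> int p dvd x \<longleftrightarrow> x = 0"
  by (auto dest: zdvd_imp_le)

lemma class_fun_const [intro]: "class_fun (\<lambda>x. c)"
  by (simp add: class_fun_def)

lemma class_funD: "class_fun f \<Longrightarrow> [x = y] (mod int p) \<Longrightarrow> f x = f y"
  by (simp add: class_fun_def)

lemma class_fun_op: "class_fun f \<Longrightarrow> class_fun g \<Longrightarrow> class_fun (\<lambda>x. F (f x) (g x))"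
  unfolding class_fun_def by metis

lemma class_fun_comp:
  assumes "class_fun f" "\<And>x y. [x = y] (mod int p) \<Longrightarrow> [h x = h y] (mod int p)"
  shows "class_fun (\<lambda>x. F (f (h x)))"
  using assms unfolding class_fun_def by metis

lemma chi_class_fun: "class_fun \<chi>"
proof -
  have "[x = 0] (mod int p) \<longleftrightarrow> [y = 0] (mod int p)" "QuadRes (int p) x \<longleftrightarrow> QuadRes (int p) y"
    if "[x = y] (mod int p)" for x y
    using that unfolding QuadRes_def by (meson cong_sym cong_trans)+
  then have "\<chi> x = \<chi> y" if "[x = y] (mod int p)" for x y
    unfolding Legendre_def using that by (simp only:)
  then show ?thesis
    unfolding class_fun_def by blast
qed

lemma e_class_fun: "class_fun e"
  unfolding class_fun_def
proof (intro allI impI)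
  fix x y assume "[x = y] (mod int p)"
  then obtain k where "y = x + int p * k"
    by (metis cong_iff_lin)
  then have "2 * pi * of_int y / real p = 2 * pi * of_int x / real p + 2 * pi * of_int k"
    using p_pos by (simp add: field_simps)
  then have "e y = e x * cis (2 * pi * of_int k)"
    unfolding e_def cis_mult by (simp only:)
  then show "e x = e y"
    by (simp add: cis_multiple_2pi)
qed

text \<open>
  Repeated application of these rules shows that an expression built from \<open>\<chi>\<close>, \<open>e\<close> and integer polynomials
  in the variable depends only on the residue of the variable.
\<close>

lemmas class_fun_intros =
  class_fun_const chi_class_fun e_class_fun
  class_fun_comp[where F = "\<lambda>x. x", OF chi_class_fun]
  class_fun_comp[where F = "\<lambda>x. x", OF e_class_fun]
  class_fun_comp[where F = "of_int", OF chi_class_fun]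
  class_fun_op[where F = "(*)"] class_fun_op[where F = "(+)"] class_fun_op[where F = "(-)"]
  cong_refl cong_add cong_mult cong_diff cong_pow

lemma e_add: "e (a + b) = e a * e b"
  by (simp add: e_def cis_mult ring_distribs add_divide_distrib)

lemma e_0 [simp]: "e 0 = 1"
  by (simp add: e_def)

lemma norm_e [simp]: "norm (e a) = 1"
  by (simp add: e_def)

lemma e_uminus: "e (- a) = cnj (e a)"
  by (simp add: e_def cis_cnj)

lemma e_eq_1D: "e a = 1 \<Longrightarrow> int p dvd a"
proof -
  assume "e a = 1"
  then have "cos (2 * pi * of_int a / real p) = 1"
    by (simp add: e_def complex_eq_iff)
  then obtain n :: int where "2 * pi * of_int a / real p = of_int n * 2 * pi"
    by (auto simp: cos_one_2pi_int)
  then have "real_of_int a = real_of_int (int p * n)"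
    using p_pos by (simp add: field_simps)
  then have "a = int p * n"
    by linarith
  then show ?thesis by simp
qed

text \<open>
  An affine map with a slope prime to \<open>p\<close> permutes the residues. All changes of variable in sums below are
  instances.
\<close>

lemma sum_affine:
  assumes "class_fun f" "\<not> int p dvd a"
  shows "(\<Sum>x\<in>\<F>. f (a * x + b)) = (\<Sum>x\<in>\<F>. f x)"
proof -
  define g where "g = (\<lambda>x. (a * x + b) mod int p)"
  have "inj_on g \<F>"
  proof (rule inj_onI)
    fix x y assume xy: "x \<in> \<F>" "y \<in> \<F>" "g x = g y"
    then have "[a * x + b = a * y + b] (mod int p)"
      by (simp add: g_def cong_def)
    then have "[x = y] (mod int p)"
      using assms(2) by (simp add: cong_add_rcancel cong_mult_lcancel coprime_p_iff)
    then show "x = y" using xy cong_residues_imp_eq by blast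
  qed
  moreover have "g ` \<F> \<subseteq> \<F>"
    using p_pos by (auto simp: g_def)
  ultimately have "bij_betw g \<F> \<F>"
    by (simp add: bij_betw_def endo_inj_surj)
  then have "(\<Sum>x\<in>\<F>. f (g x)) = (\<Sum>x\<in>\<F>. f x)"
    by (rule sum.reindex_bij_betw)
  moreover have "f (g x) = f (a * x + b)" for x
    by (rule class_funD[OF assms(1)]) (simp add: g_def)
  ultimately show ?thesis by simp
qed

lemma sum_shift: "class_fun f \<Longrightarrow> (\<Sum>x\<in>\<F>. f (x + b)) = (\<Sum>x\<in>\<F>. f x)"
  using sum_affine[of f 1 b] not_dvd_1 by simp

lemma sum_scale: "class_fun f \<Longrightarrow> \<not> int p dvd a \<Longrightarrow> (\<Sum>x\<in>\<F>. f (a * x)) = (\<Sum>x\<in>\<F>. f x)"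
  using sum_affine[of f a 0] by simp

lemma square_cong_iff: "[t\<^sup>2 = s\<^sup>2] (mod int p) \<longleftrightarrow> [t = s] (mod int p) \<or> [t = - s] (mod int p)"
proof -
  have "t\<^sup>2 - s\<^sup>2 = (t - s) * (t - (- s))"
    by (simp add: power2_eq_square algebra_simps)
  then show ?thesis
    by (metis cong_iff_dvd_diff dvd_mult_p_iff)
qed

lemma sum_square_roots:
  assumes "class_fun f" "\<not> int p dvd s"
  shows "(\<Sum>t | t \<in> \<F> \<and> [t\<^sup>2 = s\<^sup>2] (mod int p). f t) = f s + f (- s)"
proof -
  have "{t \<in> \<F>. [t\<^sup>2 = s\<^sup>2] (mod int p)} = {s mod int p, (- s) mod int p}"
    unfolding square_cong_iff using p_pos by (auto simp: cong_def)
  moreover have "s mod int p \<noteq> (- s) mod int p"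
  proof
    assume "s mod int p = (- s) mod int p"
    then have "[s = - s] (mod int p)"
      by (simp only: cong_def)
    then have "int p dvd s - (- s)"
      by (simp only: cong_iff_dvd_diff)
    then have "int p dvd 2 * s" by simp
    then show False
      using assms(2) not_dvd_2 dvd_mult_p_iff by blast
  qed
  moreover have "f (s mod int p) = f s" "f ((- s) mod int p) = f (- s)"
    by (auto intro!: class_funD[OF assms(1)])
  ultimately show ?thesis by simp
qed

section \<open>The Legendre symbol\<close>

lemma chi_0_iff: "\<chi> a = 0 \<longleftrightarrow> int p dvd a"
  by (simp add: Legendre_def cong_0_iff)

lemma chi_cases: "\<chi> a = 0 \<or> \<chi> a = 1 \<or> \<chi> a = - 1"
  by (simp add: Legendre_def)

lemma chi_nonzero: "\<not> int p dvd a \<Longrightarrow> \<chi> a = 1 \<or> \<chi> a = - 1"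
  using chi_cases chi_0_iff by blast

lemma euler: "[\<chi> a = a ^ ((p - 1) div 2)] (mod int p)"
  using euler_criterion[OF prime_p] p_ge_5 by simp

text \<open>
  Values in \<open>{0, 1, -1}\<close> differ by at most \<open>2 < p\<close>. This turns congruences obtained from Euler's criterion
  into equalities.
\<close>

lemma sign_cong_imp_eq:
  assumes "[a = b] (mod int p)" "a \<in> {0, 1, - 1}" "b \<in> {0, 1, - 1}"
  shows "a = b"
proof (rule ccontr)
  assume "a \<noteq> b"
  then have "int p \<le> \<bar>a - b\<bar>"
    using assms(1) by (intro zdvd_imp_le) (auto simp: cong_iff_dvd_diff)
  moreover have "\<bar>a - b\<bar> \<le> 2" using assms(2,3) by auto
  ultimately show False using p_ge_5 by linarith
qed

lemma chi_mult: "\<chi> (a * b) = \<chi> a * \<chi> b"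
proof (rule sign_cong_imp_eq)
  show "[\<chi> (a * b) = \<chi> a * \<chi> b] (mod int p)"
    using euler[of "a * b"] cong_mult[OF euler[of a] euler[of b]]
    by (simp add: power_mult_distrib) (metis cong_sym cong_trans)
  show "\<chi> a * \<chi> b \<in> {0, 1, - 1}"
    using chi_cases[of a] chi_cases[of b] by auto
qed (use chi_cases in auto)

lemma chi_power2: "\<not> int p dvd a \<Longrightarrow> \<chi> (a\<^sup>2) = 1"
  using chi_nonzero[of a] by (auto simp: power2_eq_square chi_mult)

lemma chi_mult_self: "\<not> int p dvd a \<Longrightarrow> \<chi> a * \<chi> a = 1"
  using chi_nonzero[of a] by auto

lemma chi_minus_1: "\<chi> (- 1) = 1"
proof (rule sign_cong_imp_eq)
  have "4 dvd p - 1"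
    using p_mod_4 p_ge_5 by presburger
  then have "even ((p - 1) div 2)"
    by auto
  then show "[\<chi> (- 1) = 1] (mod int p)"
    using euler[of "- 1"] by simp
qed (use chi_cases in auto)

lemma chi_uminus: "\<chi> (- a) = \<chi> a"
  using chi_mult[of "- 1" a] chi_minus_1 by simp

lemma obtain_sqrt_minus_1:
  obtains i where "[i\<^sup>2 = - 1] (mod int p)"
  using chi_minus_1 unfolding Legendre_def QuadRes_def by (auto split: if_splits)

text \<open>
  Squaring identifies \<open>1\<close> and \<open>-1\<close>, so it is not injective on the finite set of residues and hence not
  surjective.
\<close>

lemma obtain_nonresidue:
  obtains g where "\<chi> g = - 1"
proof (cases "\<exists>g. \<chi> g = - 1")
  case False
  define q where "q = (\<lambda>x. x\<^sup>2 mod int p)"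
  have "\<F> \<subseteq> q ` \<F>"
  proof
    fix a assume a: "a \<in> \<F>"
    have "\<exists>y. [y\<^sup>2 = a] (mod int p)"
    proof (cases "[a = 0] (mod int p)")
      case True
      then show ?thesis using cong_sym[OF True] by (intro exI[of _ 0]) simp
    next
      case nz: False
      have "\<chi> a \<noteq> - 1" using False by blast
      then show ?thesis
        using nz by (auto simp: Legendre_def QuadRes_def split: if_splits)
    qed
    then obtain y where y: "[y\<^sup>2 = a] (mod int p)" by blast
    have "q (y mod int p) = a"
      using y a by (simp add: q_def cong_def power_mod)
    moreover have "y mod int p \<in> \<F>" using p_pos by simp
    ultimately show "a \<in> q ` \<F>" by blast
  qed
  moreover have "q ` \<F> \<subseteq> \<F>" using p_pos by (auto simp: q_def)
  ultimately have "q ` \<F> = \<F>" by simp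
  then have "inj_on q \<F>"
    by (intro eq_card_imp_inj_on) simp_all
  moreover have "q 1 = q (int p - 1)"
    using cong_iff_dvd_diff[of "1\<^sup>2" "(int p - 1)\<^sup>2" "int p"]
    by (simp add: q_def cong_def power2_eq_square algebra_simps)
  moreover have "1 \<in> \<F>" "int p - 1 \<in> \<F>" using p_ge_5 by auto
  ultimately have "1 = int p - 1" by (meson inj_onD)
  then have False using p_ge_5 by simp
  then show ?thesis ..
qed (use that in blast)

text \<open>
  Multiplying the variable by a nonresidue negates the sum.
\<close>

lemma sum_chi: "(\<Sum>x\<in>\<F>. \<chi> x) = 0"
proof -
  obtain g where g: "\<chi> g = - 1" by (rule obtain_nonresidue)
  then have "\<not> int p dvd g" using chi_0_iff[of g] by auto
  then have "(\<Sum>x\<in>\<F>. \<chi> (g * x)) = (\<Sum>x\<in>\<F>. \<chi> x)"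
    by (intro sum_scale chi_class_fun)
  then show ?thesis
    using g by (simp add: chi_mult sum_negf)
qed

section \<open>Quadratic Gauss sums up to sign\<close>

text \<open>
  Shifting the variable multiplies the sum by \<open>e 1 \<noteq> 1\<close>.
\<close>

lemma sum_e: "\<not> int p dvd a \<Longrightarrow> (\<Sum>x\<in>\<F>. e (a * x)) = 0"
proof -
  assume a: "\<not> int p dvd a"
  have "(\<Sum>x\<in>\<F>. e (a * x)) = (\<Sum>x\<in>\<F>. e x)"
    using a by (intro sum_scale e_class_fun)
  moreover have "(\<Sum>x\<in>\<F>. e x) = (\<Sum>x\<in>\<F>. e (x + 1))"
    by (rule sum_shift[OF e_class_fun, symmetric])
  moreover have "\<dots> = e 1 * (\<Sum>x\<in>\<F>. e x)"
    by (simp add: e_add sum_distrib_left mult.commute)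
  moreover have "e 1 \<noteq> 1" using e_eq_1D[of 1] not_dvd_1 by auto
  ultimately show ?thesis by (metis mult_cancel_right1 mult_1)
qed

lemma card_square_roots: "int (card {x \<in> \<F>. [x\<^sup>2 = y] (mod int p)}) = 1 + \<chi> y"
proof (cases "[y = 0] (mod int p)")
  case True
  then have "[x\<^sup>2 = y] (mod int p) \<longleftrightarrow> int p dvd x" for x
    by (metis cong_0_iff cong_sym cong_trans dvd_power2_p_iff)
  then have "{x \<in> \<F>. [x\<^sup>2 = y] (mod int p)} = {0}"
    using p_pos dvd_residue_iff by auto
  then show ?thesis
    using True chi_0_iff[of y] by (simp add: cong_0_iff)
next
  case nz: False
  show ?thesis
  proof (cases "QuadRes (int p) y")
    case True
    then obtain s where s: "[s\<^sup>2 = y] (mod int p)" by (auto simp: QuadRes_def)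
    then have eq: "[x\<^sup>2 = y] (mod int p) \<longleftrightarrow> [x\<^sup>2 = s\<^sup>2] (mod int p)" for x
      by (meson cong_sym cong_trans)
    have "\<not> int p dvd s"
      using s nz by (metis cong_0_iff cong_sym cong_trans dvd_power2_p_iff)
    then have "(\<Sum>t | t \<in> \<F> \<and> [t\<^sup>2 = s\<^sup>2] (mod int p). 1 :: int) = 1 + 1"
      by (intro sum_square_roots class_fun_const)
    then show ?thesis
      using nz True by (simp add: eq Legendre_def)
  next
    case False
    then have empty: "{x \<in> \<F>. [x\<^sup>2 = y] (mod int p)} = {}"
      by (auto simp: QuadRes_def)
    show ?thesis
      unfolding empty using nz False by (simp add: Legendre_def)
  qed
qed

text \<open>
  Each residue \<open>y\<close> has exactly \<open>1 + \<chi> y\<close> square roots.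
\<close>

lemma sum_over_squares:
  fixes f :: "int \<Rightarrow> complex"
  assumes "class_fun f"
  shows "(\<Sum>x\<in>\<F>. f (x\<^sup>2)) = (\<Sum>y\<in>\<F>. (1 + of_int (\<chi> y)) * f y)"
proof -
  have "(\<Sum>x\<in>\<F>. f (x\<^sup>2)) = (\<Sum>y\<in>\<F>. \<Sum>x | x \<in> \<F> \<and> x\<^sup>2 mod int p = y. f (x\<^sup>2))"
    using p_pos by (intro sum.group[symmetric]) auto
  also have "\<dots> = (\<Sum>y\<in>\<F>. (1 + of_int (\<chi> y)) * f y)"
  proof (rule sum.cong[OF refl])
    fix y assume y: "y \<in> \<F>"
    have "(\<Sum>x | x \<in> \<F> \<and> x\<^sup>2 mod int p = y. f (x\<^sup>2)) =
          (\<Sum>x | x \<in> \<F> \<and> [x\<^sup>2 = y] (mod int p). f y)"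
      using y by (intro sum.cong class_funD[OF assms]) (auto simp: cong_def)
    also have "\<dots> = of_int (int (card {x \<in> \<F>. [x\<^sup>2 = y] (mod int p)})) * f y"
      by simp
    also have "\<dots> = (1 + of_int (\<chi> y)) * f y"
      unfolding card_square_roots by simp
    finally show "(\<Sum>x | x \<in> \<F> \<and> x\<^sup>2 mod int p = y. f (x\<^sup>2)) = (1 + of_int (\<chi> y)) * f y" .
  qed
  finally show ?thesis .
qed

definition gauss :: "int \<Rightarrow> complex" where
  "gauss a = (\<Sum>x\<in>\<F>. e (a * x\<^sup>2))"

lemma gauss_dvd: "int p dvd a \<Longrightarrow> gauss a = of_nat p"
proof -
  assume "int p dvd a"
  then have "e (a * x\<^sup>2) = e 0" for x
    by (intro class_funD[OF e_class_fun]) (simp add: cong_0_iff)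
  then show ?thesis by (simp add: gauss_def)
qed

lemma gauss_eq_chi_sum:
  assumes "\<not> int p dvd a"
  shows "gauss a = (\<Sum>y\<in>\<F>. of_int (\<chi> y) * e (a * y))"
proof -
  have "gauss a = (\<Sum>y\<in>\<F>. (1 + of_int (\<chi> y)) * e (a * y))"
    unfolding gauss_def by (rule sum_over_squares[of "\<lambda>y. e (a * y)"]) (rule class_fun_intros | assumption)+
  also have "\<dots> = (\<Sum>y\<in>\<F>. e (a * y)) + (\<Sum>y\<in>\<F>. of_int (\<chi> y) * e (a * y))"
    by (simp add: ring_distribs sum.distrib)
  finally show ?thesis using sum_e[OF assms] by simp
qed

text \<open>
  Replacing \<open>y\<close> by \<open>a y\<close> in the expression through the Legendre symbol pulls out the factor \<open>\<chi> a\<close>.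
\<close>

lemma gauss_eq_chi: "\<not> int p dvd a \<Longrightarrow> gauss a = of_int (\<chi> a) * gauss 1"
proof -
  assume a: "\<not> int p dvd a"
  have "of_int (\<chi> a) * gauss 1 = (\<Sum>y\<in>\<F>. of_int (\<chi> a) * (of_int (\<chi> y) * e y))"
    by (subst gauss_eq_chi_sum[OF not_dvd_1]) (simp add: sum_distrib_left)
  also have "(\<Sum>y\<in>\<F>. of_int (\<chi> a) * (of_int (\<chi> y) * e y)) =
        (\<Sum>y\<in>\<F>. of_int (\<chi> a) * (of_int (\<chi> (a * y)) * e (a * y)))"
    by (rule sum_scale[where f = "\<lambda>y. of_int (\<chi> a) * (of_int (\<chi> y) * e y)", OF _ a, symmetric])
       (rule class_fun_intros | assumption)+
  also have "\<dots> = (\<Sum>y\<in>\<F>. of_int (\<chi> a * \<chi> a) * (of_int (\<chi> y) * e (a * y)))"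
    by (simp add: chi_mult mult_ac)
  also have "\<dots> = gauss a"
    by (simp add: chi_mult_self a gauss_eq_chi_sum)
  finally show ?thesis by simp
qed

lemma cnj_gauss: "cnj (gauss 1) = gauss 1"
proof -
  have "cnj (gauss 1) = gauss (- 1)"
    by (simp add: gauss_def e_uminus)
  also have "\<dots> = gauss 1"
    using gauss_eq_chi[of "- 1"] not_dvd_1 chi_minus_1 by simp
  finally show ?thesis .
qed

text \<open>
  The sum is real because \<open>-1\<close> is a square, so its square equals its squared norm. In the double sum over
  \<open>e (y\<^sup>2 - x\<^sup>2)\<close> the substitution \<open>y = d + x\<close> makes the phase linear in \<open>x\<close>, and orthogonality leaves only
  the terms with \<open>d = 0\<close>.
\<close>

lemma gauss_squared: "(gauss 1)\<^sup>2 = of_nat p"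
proof -
  have "(gauss 1)\<^sup>2 = cnj (gauss 1) * gauss 1"
    by (simp add: cnj_gauss power2_eq_square)
  also have "\<dots> = (\<Sum>x\<in>\<F>. \<Sum>y\<in>\<F>. e (- (x\<^sup>2)) * e (y\<^sup>2))"
    by (simp add: gauss_def sum_product e_uminus)
  also have "\<dots> = (\<Sum>x\<in>\<F>. \<Sum>d\<in>\<F>. e (- (x\<^sup>2)) * e ((d + x)\<^sup>2))"
    by (intro sum.cong refl sum_shift[where f = "\<lambda>y. e (- (x\<^sup>2)) * e (y\<^sup>2)" for x, symmetric])
       (rule class_fun_intros | assumption)+
  also have "\<dots> = (\<Sum>x\<in>\<F>. \<Sum>d\<in>\<F>. e (d\<^sup>2) * e ((2 * d) * x))"
    by (intro sum.cong refl) (simp add: e_add[symmetric] power2_eq_square algebra_simps)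
  also have "\<dots> = (\<Sum>d\<in>\<F>. e (d\<^sup>2) * (\<Sum>x\<in>\<F>. e ((2 * d) * x)))"
    by (subst sum.swap) (simp add: sum_distrib_left)
  also have "\<dots> = (\<Sum>d\<in>\<F>. if d = 0 then of_nat p else 0)"
  proof (intro sum.cong refl)
    fix d assume d: "d \<in> \<F>"
    show "e (d\<^sup>2) * (\<Sum>x\<in>\<F>. e ((2 * d) * x)) = (if d = 0 then of_nat p else 0)"
    proof (cases "d = 0")
      case False
      then have "\<not> int p dvd 2 * d"
        using d not_dvd_2 dvd_residue_iff[of d] by (simp add: dvd_mult_p_iff)
      then show ?thesis using False sum_e by simp
    qed simp
  qed
  also have "\<dots> = of_nat p"
    using p_pos by simp
  finally show ?thesis .
qed

section \<open>The sign of the quadratic Gauss sum\<close>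

text \<open>
  The inverse of \<open>2\<close> modulo \<open>p\<close>. Reordering the Gauss sum by \<open>x = half * r\<close> gives the terms the phases
  \<open>r\<^sup>2 / (4 p)\<close>, in units of a full turn and up to quarter turns. Their increments are governed by
  \<open>sin (\<pi> r / p)\<close>, which increases on the whole range \<open>1 \<le> r \<le> (p - 1) / 2\<close>; in the original order the increments would involve \<open>sin (2 \<pi> r / p)\<close>, which returns
  to \<open>0\<close> at the end of that range.
\<close>

definition half :: int where "half = (int p + 1) div 2"

definition chirp :: "nat \<Rightarrow> complex" where "chirp r = e (half\<^sup>2 * (int r)\<^sup>2)"

lemma two_half: "2 * half = int p + 1"
  using p_mod_4 unfolding half_def by presburger

lemma real_half: "real_of_int half = (real p + 1) / 2"
  using arg_cong[OF two_half, of real_of_int] by simp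

lemma norm_chirp [simp]: "norm (chirp r) = 1"
  by (simp add: chirp_def)

lemma not_dvd_half: "\<not> int p dvd half"
proof
  assume "int p dvd half"
  then have "int p dvd 2 * half - int p" by simp
  then show False using not_dvd_1 two_half by simp
qed

lemma e_half: "e (2 * half\<^sup>2 * int r) = (- 1) ^ r * cis (pi * real r / real p)"
proof -
  obtain k where k: "p = 4 * k + 1"
    using p_mod_4 by (metis mod_div_decomp mult.commute)
  have "2 * pi * real_of_int (2 * half\<^sup>2 * int r) / real p
      = real r * pi * (real p + 2) + pi * real r / real p"
    using p_pos by (simp add: real_half field_simps power2_eq_square)
  also have "real r * pi * (real p + 2) = pi * real (r * (p + 2))"
    by (simp add: algebra_simps)
  finally have "e (2 * half\<^sup>2 * int r) = cis (pi * real (r * (p + 2))) * cis (pi * real r / real p)"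
    by (simp only: e_def cis_mult)
  also have "cis (pi * real (r * (p + 2))) = (- 1) ^ (r * (p + 2))"
    using Complex.DeMoivre[of pi "r * (p + 2)"] by (simp add: mult.commute)
  also have "\<dots> = (- 1) ^ r"
    using k by (simp add: power_mult minus_one_power_iff)
  finally show ?thesis .
qed

text \<open>
  A discrete derivative: each term \<open>chirp r\<close> is a difference of its neighbours divided by a sine. This prepares
  the sum for summation by parts.
\<close>

lemma chirp_difference:
  assumes "r > 0"
  shows "(- 1) ^ r * (chirp (Suc r) - chirp (r - 1)) = e (half\<^sup>2) * (2 * \<i> * of_real (sin (pi * real r / real p))) * chirp r"
proof -
  have "half\<^sup>2 * (int (Suc r))\<^sup>2 = half\<^sup>2 * (int r)\<^sup>2 + half\<^sup>2 + 2 * half\<^sup>2 * int r"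
    "half\<^sup>2 * (int (r - 1))\<^sup>2 = half\<^sup>2 * (int r)\<^sup>2 + half\<^sup>2 + - (2 * half\<^sup>2 * int r)"
    using assms by (auto simp: power2_eq_square algebra_simps of_nat_diff)
  then have "chirp (Suc r) - chirp (r - 1)
      = chirp r * e (half\<^sup>2) * (e (2 * half\<^sup>2 * int r) - e (- (2 * half\<^sup>2 * int r)))"
    unfolding chirp_def by (simp only: e_add) (simp add: algebra_simps)
  also have "e (2 * half\<^sup>2 * int r) - e (- (2 * half\<^sup>2 * int r))
      = (- 1) ^ r * (2 * \<i> * of_real (sin (pi * real r / real p)))"
    unfolding e_uminus e_half by (simp add: complex_eq_iff minus_one_power_iff)
  finally show ?thesis
    by (simp add: minus_one_power_iff)
qed

text \<open>
  For even \<open>r\<close> the real part is \<open>cos (\<pi> v / 2)\<close> and for odd \<open>r\<close> it is \<open>sin (\<pi> v / 2)\<close>, where \<open>v = r\<^sup>2 / p\<close>.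
  The bounds are the chords of these functions on \<open>0 \<le> v \<le> 1\<close>.
\<close>

lemma Re_chirp_ge:
  assumes "r\<^sup>2 \<le> p"
  shows "Re (chirp r) \<ge> (if even r then 1 - (real r)\<^sup>2 / real p else (real r)\<^sup>2 / real p)"
proof -
  obtain k where k: "p = 4 * k + 1"
    using p_mod_4 by (metis mod_div_decomp mult.commute)
  define v where "v = (real r)\<^sup>2 / real p"
  have v: "0 \<le> v" "v \<le> 1"
    using assms p_pos by (auto simp: v_def divide_le_eq simp flip: of_nat_power)
  have "2 * pi * real_of_int (half\<^sup>2 * (int r)\<^sup>2) / real p = pi / 2 * real ((p + 2) * r\<^sup>2) + pi / 2 * v"
    using p_pos by (simp add: real_half v_def field_simps power2_eq_square)
  then have chirp: "chirp r = cis (pi / 2 * real ((p + 2) * r\<^sup>2)) * cis (pi / 2 * v)"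
    by (simp only: chirp_def e_def cis_mult)
  have "cis (pi / 2 * real ((p + 2) * r\<^sup>2)) = \<i> ^ ((p + 2) * r\<^sup>2)"
    using Complex.DeMoivre[of "pi / 2" "(p + 2) * r\<^sup>2"] by (simp add: mult.commute)
  also have "\<i> ^ ((p + 2) * r\<^sup>2) = (if even r then 1 else - \<i>)"
  proof (cases "even r")
    case True
    then obtain j where "r = 2 * j" by blast
    then have "(p + 2) * r\<^sup>2 = 4 * ((p + 2) * j\<^sup>2)" by (simp add: power2_eq_square)
    then show ?thesis using True by (simp only: power_mult) simp
  next
    case False
    then obtain j where j: "r = 2 * j + 1" by (auto elim: oddE)
    have "(p + 2) * r\<^sup>2 = 4 * (k * r\<^sup>2 + 3 * (j\<^sup>2 + j)) + 3"
      by (simp add: j k power2_eq_square algebra_simps)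
    then show ?thesis using False by (simp only: power_mult power_add) (simp add: power3_eq_cube)
  qed
  finally have chirp': "chirp r = (if even r then 1 else - \<i>) * cis (pi / 2 * v)"
    using chirp by simp
  have "2 / pi * (pi / 2 * v) \<le> sin (pi / 2 * v)"
    "2 / pi * (pi / 2 * (1 - v)) \<le> sin (pi / 2 * (1 - v))"
    using v by (intro sin_ge_linear; simp)+
  moreover have "sin (pi / 2 * (1 - v)) = cos (pi / 2 * v)"
    by (simp only: cos_sin_eq right_diff_distrib mult_1_right of_real_eq_id id_apply)
  ultimately show ?thesis
    by (simp add: chirp' v_def[symmetric])
qed

lemma gauss_eq_sum_chirp: "gauss 1 = 1 + 2 * (\<Sum>r = 1..(p - 1) div 2. chirp r)"
proof -
  define n where "n = (p - 1) div 2"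
  have p: "p = 2 * n + 1" using p_mod_4 unfolding n_def by presburger
  have chirp_reflect: "chirp (p - r) = chirp r" if "r \<le> p" for r
  proof -
    have "[int (p - r) = - int r] (mod int p)"
      using that by (simp add: cong_iff_dvd_diff of_nat_diff)
    then have "[half\<^sup>2 * (int (p - r))\<^sup>2 = half\<^sup>2 * (- int r)\<^sup>2] (mod int p)"
      by (intro cong_mult cong_pow cong_refl)
    then show ?thesis
      unfolding chirp_def by (intro class_funD[OF e_class_fun]) simp
  qed
  have "gauss 1 = (\<Sum>x\<in>\<F>. e ((half * x)\<^sup>2))"
    unfolding gauss_def mult_1
    by (rule sum_scale[where f = "\<lambda>x. e (x\<^sup>2)", OF _ not_dvd_half, symmetric])
       (rule class_fun_intros | assumption)+
  also have "\<dots> = (\<Sum>r\<in>{0..<p}. chirp r)"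
    by (rule sum.reindex_bij_witness[of _ int nat]) (auto simp: chirp_def power_mult_distrib)
  also have "{0..<p} = {0} \<union> {1..n} \<union> {n + 1..2 * n}"
    using p by auto
  also have "(\<Sum>r\<in>\<dots>. chirp r) = chirp 0 + (\<Sum>r=1..n. chirp r) + (\<Sum>r=n+1..2*n. chirp r)"
    by (subst sum.union_disjoint; (subst sum.union_disjoint)?) auto
  also have "(\<Sum>r=n+1..2*n. chirp r) = (\<Sum>r=1..n. chirp r)"
  proof (rule sum.reindex_bij_witness[of _ "\<lambda>r. p - r" "\<lambda>r. p - r"])
    show "chirp (p - r) = chirp r" if "r \<in> {n + 1..2 * n}" for r
      by (rule chirp_reflect) (use that p in auto)
  qed (use p in auto)
  finally show ?thesis by (simp add: n_def chirp_def)
qed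

text \<open>
  Gauss's determination of the sign, by a real-variable estimate in the manner of Estermann. Since the square of
  the sum is \<open>p\<close>, it suffices that the real part exceeds \<open>- sqrt p\<close>. For \<open>r \<le> m\<close>, with \<open>m\<close> the integer part of
  \<open>sqrt p\<close>, the terms have nonnegative real parts, which add up to more than \<open>sqrt p - 2\<close> in total. Summation by
  parts bounds the remaining terms by \<open>2 sqrt p - 2\<close>.
\<close>

theorem gauss_sum_value: "gauss 1 = of_real (sqrt (real p))"
proof -
  define n where "n = (p - 1) div 2"
  have p: "p = 2 * n + 1" using p_mod_4 unfolding n_def by presburger
  \<comment> \<open>Up to \<open>m\<close> the quotient \<open>r\<^sup>2 / p\<close> stays in \<open>[0, 1]\<close>, where the lower bounds for the real parts are valid.\<close>
  define m where "m = nat \<lfloor>sqrt (real p)\<rfloor>"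
  have m_le: "real m \<le> sqrt (real p)" and m_gt: "sqrt (real p) < real m + 1"
    unfolding m_def by (auto simp: floor_le_iff le_nat_iff)
  have m2: "m\<^sup>2 \<le> p"
  proof -
    have "(real m)\<^sup>2 \<le> (sqrt (real p))\<^sup>2" using m_le by (intro power_mono) auto
    then show ?thesis by (simp flip: of_nat_power)
  qed
  have sqrt_gt: "2 < sqrt (real p)" using p_ge_5 by (intro real_less_rsqrt) auto
  then have m_ge: "2 \<le> m" unfolding m_def by linarith
  have mn: "m \<le> n"
  proof (rule ccontr)
    assume "\<not> m \<le> n"
    then have "p \<le> 2 * m - 1" using p by simp
    moreover have "2 * m \<le> m * m" using m_ge by simp
    ultimately show False using m2 m_ge unfolding power2_eq_square by linarith
  qed

  have main: "1 + 2 * (\<Sum>r = 1..m. Re (chirp r)) \<ge> real m - 1"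
  proof -
    have "real m - 2 \<le> 2 * (real (m div 2) - (- 1) ^ m * (real m * (real m + 1) / (2 * real p)))"
    proof (cases "even m")
      case True
      have "real m * (real m + 1) \<le> 2 * real m * real m"
        using m_ge by (simp add: mult_left_mono)
      also have "\<dots> \<le> 2 * real p" using m2 by (simp add: power2_eq_square flip: of_nat_mult)
      finally have "real m * (real m + 1) / (2 * real p) \<le> 1"
        using p_pos by simp
      then show ?thesis using True by (auto elim!: evenE)
    next
      case False
      have "0 \<le> real m * (real m + 1) / real p" by simp
      moreover have "real m - 2 \<le> 2 * real (m div 2)" using False by (auto elim!: oddE)
      ultimately show ?thesis using False by (simp add: add_increasing2)
    qed
    also have "\<dots> \<le> 2 * (\<Sum>r = 1..m. Re (chirp r))"
      unfolding alternating_sum_of_squares[symmetric]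
    proof (intro mult_left_mono sum_mono Re_chirp_ge)
      fix r assume "r \<in> {1..m}"
      then have "r\<^sup>2 \<le> m\<^sup>2" by (intro power_mono) auto
      then show "r\<^sup>2 \<le> p" using m2 by linarith
    qed simp
    finally show ?thesis by simp
  qed

  have tail: "2 * norm (\<Sum>r = Suc m..n. chirp r) < 2 * sqrt (real p) - 2"
  proof (cases "m = n")
    case True
    then show ?thesis using p_ge_5 by simp
  next
    case False
    then have "m < n" using mn by simp
    define s where "s r = sin (pi * real r / real p)" for r
    define B where "B r = (- 1) ^ r * (chirp (Suc r) - chirp r)" for r
    have norm_B: "norm (B r) \<le> 2" for r
      using norm_triangle_ineq4[of "chirp (Suc r)" "chirp r"] by (simp add: B_def norm_mult norm_power)
    have angle: "pi * real r / real p \<le> pi / 2" if "r \<le> n" for r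
      using that p p_pos mult_left_mono[of "2 * real r" "real p" pi] by (simp add: field_simps)
    have s_ge: "2 * real r / real p \<le> s r" if "r \<le> n" for r
      using sin_ge_linear[of "pi * real r / real p"] angle[OF that] by (simp add: s_def)
    have s_pos: "0 < s r" if "0 < r" "r \<le> n" for r
      using s_ge[OF that(2)] that(1) p_pos by (smt (verit) divide_pos_pos of_nat_0_less_iff)
    have s_mono: "s r \<le> s (Suc r)" if "r < n" for r
      unfolding s_def
    proof (rule sin_monotone_2pi_le)
      have "0 \<le> pi * real r / real p" by simp
      then show "- (pi / 2) \<le> pi * real r / real p" using pi_gt_zero by linarith
      show "pi * real r / real p \<le> pi * real (Suc r) / real p"
        by (intro divide_right_mono mult_left_mono) auto
    qed (use that angle[of "Suc r"] in simp)
    \<comment> \<open>The terms are symmetric about \<open>p / 2\<close>, so the upper boundary term of the summation by parts vanishes.\<close>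
    have "B n = 0"
    proof -
      have "[half\<^sup>2 * (int (Suc n))\<^sup>2 = half\<^sup>2 * (- int n)\<^sup>2] (mod int p)"
        using p by (intro cong_mult cong_pow cong_refl) (simp add: cong_iff_dvd_diff add.commute)
      then have "chirp (Suc n) = chirp n"
        unfolding chirp_def by (intro class_funD[OF e_class_fun]) simp
      then show ?thesis by (simp add: B_def)
    qed
    have summand: "(B r - B (r - 1)) / of_real (s r) = 2 * \<i> * e (half\<^sup>2) * chirp r" if "r \<in> {Suc m..n}" for r
    proof -
      have r: "r > 0" "r \<le> n" using that by auto
      then have "B r - B (r - 1) = (- 1) ^ r * (chirp (Suc r) - chirp (r - 1))"
        by (cases r) (simp_all add: B_def algebra_simps)
      also have "\<dots> = e (half\<^sup>2) * (2 * \<i> * of_real (s r)) * chirp r"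
        unfolding s_def by (rule chirp_difference[OF r(1)])
      finally show ?thesis using s_pos[OF r] by (simp add: field_simps)
    qed
    have "2 * norm (\<Sum>r = Suc m..n. chirp r) = norm (\<Sum>r = Suc m..n. 2 * \<i> * e (half\<^sup>2) * chirp r)"
      by (simp add: sum_distrib_left[symmetric] norm_mult)
    also have "\<dots> = norm ((\<Sum>r = Suc m..n. (B r - B (r - 1)) / of_real (s r)) - B n / of_real (s n))"
      using summand \<open>B n = 0\<close> by simp
    also have "\<dots> \<le> 4 / s (Suc m) - 2 / s n"
      using \<open>m < n\<close> norm_B s_pos s_mono by (intro norm_sum_differences_over_increasing) auto
    also have "\<dots> \<le> 2 * real p / (real m + 1) - 2"
    proof -
      have "4 / s (Suc m) \<le> 4 / (2 * real (Suc m) / real p)"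
        using s_ge[of "Suc m"] \<open>m < n\<close> p_pos by (intro divide_left_mono mult_pos_pos s_pos) auto
      moreover have "4 / (2 * real (Suc m) / real p) = 2 * real p / (real m + 1)"
        by (simp add: divide_simps)
      moreover have "2 \<le> 2 / s n"
        using s_pos[of n] \<open>m < n\<close> by (simp add: s_def field_simps)
      ultimately show ?thesis by linarith
    qed
    also have "\<dots> < 2 * sqrt (real p) - 2"
    proof -
      have "real p = sqrt (real p) * sqrt (real p)" by simp
      also have "\<dots> < sqrt (real p) * (real m + 1)"
        using m_gt p_pos by (intro mult_strict_left_mono) auto
      finally show ?thesis by (simp add: field_simps)
    qed
    finally show ?thesis .
  qed

  have split: "{1..n} = {1..m} \<union> {Suc m..n}" using mn by auto
  have "gauss 1 = 1 + 2 * ((\<Sum>r = 1..m. chirp r) + (\<Sum>r = Suc m..n. chirp r))"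
    unfolding gauss_eq_sum_chirp n_def[symmetric] split by (subst sum.union_disjoint) auto
  then have "Re (gauss 1) = 1 + 2 * (\<Sum>r = 1..m. Re (chirp r)) + 2 * Re (\<Sum>r = Suc m..n. chirp r)"
    by simp
  moreover have "\<bar>Re (\<Sum>r = Suc m..n. chirp r)\<bar> \<le> norm (\<Sum>r = Suc m..n. chirp r)"
    by (rule abs_Re_le_cmod)
  ultimately have "Re (gauss 1) > - sqrt (real p)"
    using main tail m_gt by linarith
  moreover have "gauss 1 = of_real (sqrt (real p)) \<or> gauss 1 = - of_real (sqrt (real p))"
    using gauss_squared by (simp add: power2_eq_iff[symmetric] flip: of_real_power)
  ultimately show ?thesis by auto
qed

section \<open>Jacobsthal sums\<close>

text \<open>
  For \<open>d\<close> prime to \<open>p\<close>, scaling \<open>n\<close> by \<open>d\<close> shows that the sum is independent of \<open>d\<close>. Summing over all \<open>d\<close>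
  gives \<open>0\<close>, which determines the common value from the value at \<open>d = 0\<close>.
\<close>

lemma sum_chi_mult_shift:
  "(\<Sum>n\<in>\<F>. \<chi> n * \<chi> (n + d)) = (if int p dvd d then int p - 1 else - 1)"
proof -
  define T where "T d = (\<Sum>n\<in>\<F>. \<chi> n * \<chi> (n + d))" for d
  have T0: "T d = int p - 1" if "int p dvd d" for d
  proof -
    have "\<chi> (n + d) = \<chi> n" for n
      by (rule class_funD[OF chi_class_fun]) (use that in \<open>simp add: cong_iff_dvd_diff\<close>)
    then have "T d = (\<Sum>n\<in>\<F>. if n = 0 then 0 else 1)"
      unfolding T_def using chi_mult_self chi_0_iff dvd_residue_iff by (intro sum.cong) auto
    also have "\<dots> = (\<Sum>n\<in>\<F>. 1 - (if n = 0 then 1 else 0))"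
      by (intro sum.cong) auto
    also have "\<dots> = int p - 1"
      using p_pos by (simp add: sum_subtractf)
    finally show ?thesis .
  qed
  have T_eq: "T d = T 1" if d: "\<not> int p dvd d" for d
  proof -
    have "T d = (\<Sum>n\<in>\<F>. \<chi> (d * n) * \<chi> (d * n + d))"
      unfolding T_def
      by (rule sum_scale[where f = "\<lambda>n. \<chi> n * \<chi> (n + d)", OF _ d, symmetric])
         (rule class_fun_intros | assumption)+
    also have "\<dots> = (\<Sum>n\<in>\<F>. (\<chi> d * \<chi> d) * (\<chi> n * \<chi> (n + 1)))"
    proof (intro sum.cong HOL.refl)
      fix n
      have "d * n + d = d * (n + 1)" by (simp add: algebra_simps)
      then show "\<chi> (d * n) * \<chi> (d * n + d) = (\<chi> d * \<chi> d) * (\<chi> n * \<chi> (n + 1))"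
        by (simp only: chi_mult mult_ac)
    qed
    also have "\<dots> = T 1" by (simp add: chi_mult_self[OF d] T_def)
    finally show ?thesis .
  qed
  \<comment> \<open>For fixed \<open>n\<close> the sum over \<open>d\<close> runs through all values of \<open>\<chi>\<close>, so the total vanishes.\<close>
  have "(\<Sum>d\<in>\<F>. T d) = (\<Sum>n\<in>\<F>. \<chi> n * (\<Sum>d\<in>\<F>. \<chi> (d + n)))"
    unfolding T_def by (subst sum.swap) (simp add: sum_distrib_left add.commute)
  also have "\<dots> = 0"
    by (simp add: sum_shift[OF chi_class_fun] sum_chi)
  finally have "0 = (\<Sum>d\<in>\<F>. T d)" by simp
  also have "\<dots> = T 0 + (\<Sum>d\<in>\<F> - {0}. T d)"
    using p_pos by (subst sum.remove[of _ 0]) auto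
  also have "(\<Sum>d\<in>\<F> - {0}. T d) = (\<Sum>d\<in>\<F> - {0}. T 1)"
    using dvd_residue_iff by (intro sum.cong HOL.refl T_eq) auto
  also have "\<dots> = (int p - 1) * T 1"
    using p_pos by (simp add: of_nat_diff)
  also have "T 0 = int p - 1"
    by (simp add: T0)
  finally have "(int p - 1) * (1 + T 1) = 0"
    unfolding distrib_left mult_1_right by (rule sym)
  then have "int p - 1 = 0 \<or> 1 + T 1 = 0" by (simp only: mult_eq_0_iff)
  then have "1 + T 1 = 0" using p_ge_5 by linarith
  then have "T 1 = - 1" by simp
  then have "T d = (if int p dvd d then int p - 1 else - 1)"
    using T0[of d] T_eq[of d] by simp
  then show ?thesis by (simp only: T_def)
qed

definition jacobsthal :: "int \<Rightarrow> int" where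
  "jacobsthal n = (\<Sum>t\<in>\<F>. \<chi> t * \<chi> (t\<^sup>2 + n))"

lemma jacobsthal_class_fun: "class_fun jacobsthal"
  unfolding class_fun_def jacobsthal_def
proof (intro allI impI sum.cong HOL.refl)
  fix x y t assume "[x = y] (mod int p)"
  then have "\<chi> (t\<^sup>2 + x) = \<chi> (t\<^sup>2 + y)"
    by (intro class_funD[OF chi_class_fun] cong_add cong_refl)
  then show "\<chi> t * \<chi> (t\<^sup>2 + x) = \<chi> t * \<chi> (t\<^sup>2 + y)" by simp
qed

lemma jacobsthal_0: "int p dvd n \<Longrightarrow> jacobsthal n = 0"
proof -
  assume n: "int p dvd n"
  have "\<chi> t * \<chi> (t\<^sup>2 + 0) = \<chi> t" for t
    using chi_power2[of t] chi_0_iff[of t] by (cases "int p dvd t") auto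
  then have "jacobsthal 0 = 0" by (simp only: jacobsthal_def sum_chi)
  then show ?thesis
    using class_funD[OF jacobsthal_class_fun, of n 0] n by (simp add: cong_0_iff)
qed

lemma jacobsthal_scale:
  assumes "\<not> int p dvd m"
  shows "jacobsthal (m\<^sup>2 * n) = \<chi> m * jacobsthal n"
proof -
  have "jacobsthal (m\<^sup>2 * n) = (\<Sum>t\<in>\<F>. \<chi> (m * t) * \<chi> ((m * t)\<^sup>2 + m\<^sup>2 * n))"
    unfolding jacobsthal_def
    by (rule sum_scale[where f = "\<lambda>t. \<chi> t * \<chi> (t\<^sup>2 + m\<^sup>2 * n)", OF _ assms, symmetric])
       (rule class_fun_intros | assumption)+
  also have "\<dots> = (\<Sum>t\<in>\<F>. \<chi> m * (\<chi> t * \<chi> (t\<^sup>2 + n)))"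
  proof (intro sum.cong HOL.refl)
    fix t
    have "(m * t)\<^sup>2 + m\<^sup>2 * n = m\<^sup>2 * (t\<^sup>2 + n)" by (simp add: power_mult_distrib algebra_simps)
    then show "\<chi> (m * t) * \<chi> ((m * t)\<^sup>2 + m\<^sup>2 * n) = \<chi> m * (\<chi> t * \<chi> (t\<^sup>2 + n))"
      by (simp only: chi_mult[of "m\<^sup>2"] chi_mult[of m] chi_power2[OF assms] mult_1 mult.assoc)
  qed
  finally show ?thesis by (simp add: jacobsthal_def sum_distrib_left)
qed

text \<open>
  After expanding the square, the sum over \<open>n\<close> is a correlation of the Legendre symbol. Only the pairs with
  \<open>t = \<plusminus> s\<close> contribute beyond the constant \<open>-1\<close>, whose total vanishes.
\<close>

lemma sum_jacobsthal_squared: "(\<Sum>n\<in>\<F>. (jacobsthal n)\<^sup>2) = 2 * int p * (int p - 1)"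
proof -
  have inner: "(\<Sum>n\<in>\<F>. \<chi> (s\<^sup>2 + n) * \<chi> (t\<^sup>2 + n)) = (if [t\<^sup>2 = s\<^sup>2] (mod int p) then int p else 0) - 1" for s t
  proof -
    have "(\<Sum>n\<in>\<F>. \<chi> (s\<^sup>2 + n) * \<chi> (t\<^sup>2 + n)) = (\<Sum>n\<in>\<F>. \<chi> (n + s\<^sup>2) * \<chi> ((n + s\<^sup>2) + (t\<^sup>2 - s\<^sup>2)))"
      by (simp add: algebra_simps)
    also have "\<dots> = (\<Sum>n\<in>\<F>. \<chi> n * \<chi> (n + (t\<^sup>2 - s\<^sup>2)))"
      by (rule sum_shift[where f = "\<lambda>n. \<chi> n * \<chi> (n + (t\<^sup>2 - s\<^sup>2))"])
         (rule class_fun_intros | assumption)+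
    finally show ?thesis by (simp add: sum_chi_mult_shift cong_iff_dvd_diff)
  qed
  have "(\<Sum>n\<in>\<F>. (jacobsthal n)\<^sup>2)
      = (\<Sum>n\<in>\<F>. \<Sum>s\<in>\<F>. \<Sum>t\<in>\<F>. (\<chi> s * \<chi> t) * (\<chi> (s\<^sup>2 + n) * \<chi> (t\<^sup>2 + n)))"
    by (simp add: jacobsthal_def power2_eq_square sum_product mult_ac)
  also have "\<dots> = (\<Sum>s\<in>\<F>. \<Sum>n\<in>\<F>. \<Sum>t\<in>\<F>. (\<chi> s * \<chi> t) * (\<chi> (s\<^sup>2 + n) * \<chi> (t\<^sup>2 + n)))"
    by (rule sum.swap)
  also have "\<dots> = (\<Sum>s\<in>\<F>. \<Sum>t\<in>\<F>. \<Sum>n\<in>\<F>. (\<chi> s * \<chi> t) * (\<chi> (s\<^sup>2 + n) * \<chi> (t\<^sup>2 + n)))"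
    by (intro sum.cong HOL.refl sum.swap)
  also have "\<dots> = (\<Sum>s\<in>\<F>. \<Sum>t\<in>\<F>. (\<chi> s * \<chi> t) * ((if [t\<^sup>2 = s\<^sup>2] (mod int p) then int p else 0) - 1))"
    by (simp only: sum_distrib_left[symmetric] inner)
  also have "\<dots> = (\<Sum>s\<in>\<F>. \<chi> s * (int p * (\<Sum>t | t \<in> \<F> \<and> [t\<^sup>2 = s\<^sup>2] (mod int p). \<chi> t) - (\<Sum>t\<in>\<F>. \<chi> t)))"
  proof (intro sum.cong HOL.refl)
    fix s
    have "(\<Sum>t\<in>\<F>. (\<chi> s * \<chi> t) * ((if [t\<^sup>2 = s\<^sup>2] (mod int p) then int p else 0) - 1))
        = (\<Sum>t\<in>\<F>. \<chi> s * (int p * (if [t\<^sup>2 = s\<^sup>2] (mod int p) then \<chi> t else 0)) - \<chi> s * \<chi> t)"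
      by (intro sum.cong) (auto simp: algebra_simps)
    also have "\<dots> = \<chi> s * (int p * (\<Sum>t\<in>\<F>. if [t\<^sup>2 = s\<^sup>2] (mod int p) then \<chi> t else 0) - (\<Sum>t\<in>\<F>. \<chi> t))"
      by (simp only: sum_subtractf sum_distrib_left right_diff_distrib)
    also have "(\<Sum>t\<in>\<F>. if [t\<^sup>2 = s\<^sup>2] (mod int p) then \<chi> t else 0)
        = (\<Sum>t | t \<in> \<F> \<and> [t\<^sup>2 = s\<^sup>2] (mod int p). \<chi> t)"
      by (rule sum.inter_filter[symmetric]) simp
    finally show "(\<Sum>t\<in>\<F>. (\<chi> s * \<chi> t) * ((if [t\<^sup>2 = s\<^sup>2] (mod int p) then int p else 0) - 1))
      = \<chi> s * (int p * (\<Sum>t | t \<in> \<F> \<and> [t\<^sup>2 = s\<^sup>2] (mod int p). \<chi> t) - (\<Sum>t\<in>\<F>. \<chi> t))" .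
  qed
  also have "\<dots> = (\<Sum>s\<in>\<F> - {0}. 2 * int p)"
  proof (rule sum.mono_neutral_cong_right)
    show "\<forall>s\<in>\<F> - (\<F> - {0}). \<chi> s * (int p * (\<Sum>t | t \<in> \<F> \<and> [t\<^sup>2 = s\<^sup>2] (mod int p). \<chi> t) - (\<Sum>t\<in>\<F>. \<chi> t)) = 0"
      using chi_0_iff[of 0] by auto
    fix s assume s: "s \<in> \<F> - {0}"
    then have nd: "\<not> int p dvd s" using dvd_residue_iff by blast
    show "\<chi> s * (int p * (\<Sum>t | t \<in> \<F> \<and> [t\<^sup>2 = s\<^sup>2] (mod int p). \<chi> t) - (\<Sum>t\<in>\<F>. \<chi> t)) = 2 * int p"
      unfolding sum_square_roots[OF chi_class_fun nd] sum_chi chi_uminus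
      using chi_mult_self[OF nd] by (simp add: algebra_simps)
  qed auto
  also have "\<dots> = 2 * int p * (int p - 1)"
    using p_pos by (simp add: of_nat_diff)
  finally show ?thesis .
qed

text \<open>
  The terms for \<open>t\<close> and \<open>p - t\<close> agree, and the term for \<open>0\<close> vanishes.
\<close>

lemma even_jacobsthal: "even (jacobsthal n)"
proof -
  define k where "k = (int p - 1) div 2"
  have k: "int p = 2 * k + 1" using p_mod_4 unfolding k_def by presburger
  have "\<F> = {0} \<union> {1..k} \<union> {k + 1..2 * k}" unfolding k using p_pos k by auto
  then have "jacobsthal n = (\<Sum>t\<in>{0} \<union> {1..k} \<union> {k + 1..2 * k}. \<chi> t * \<chi> (t\<^sup>2 + n))"
    unfolding jacobsthal_def by simp
  also have "\<dots> = \<chi> 0 * \<chi> n + (\<Sum>t=1..k. \<chi> t * \<chi> (t\<^sup>2 + n)) + (\<Sum>t=k+1..2*k. \<chi> t * \<chi> (t\<^sup>2 + n))"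
    by (subst sum.union_disjoint; (subst sum.union_disjoint)?) auto
  also have "(\<Sum>t=k+1..2*k. \<chi> t * \<chi> (t\<^sup>2 + n)) = (\<Sum>t=1..k. \<chi> t * \<chi> (t\<^sup>2 + n))"
  proof (rule sum.reindex_bij_witness[of _ "\<lambda>t. int p - t" "\<lambda>t. int p - t"])
    fix t
    have "[int p - t = - t] (mod int p)" by (simp add: cong_iff_dvd_diff)
    then have "[(int p - t)\<^sup>2 + n = (- t)\<^sup>2 + n] (mod int p)"
      by (intro cong_add cong_pow cong_refl)
    with \<open>[int p - t = - t] (mod int p)\<close> show "\<chi> (int p - t) * \<chi> ((int p - t)\<^sup>2 + n) = \<chi> t * \<chi> (t\<^sup>2 + n)"
      using class_funD[OF chi_class_fun] chi_uminus by (metis power2_minus)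
  qed (use k in auto)
  finally show ?thesis using chi_0_iff[of 0] by simp
qed

text \<open>
  If \<open>m n\<close> is a nonzero square \<open>k\<^sup>2\<close>, then \<open>n\<^sup>2 m\<close> and \<open>k\<^sup>2 n\<close> agree modulo \<open>p\<close>, and the scaling rule applies to
  both sides.
\<close>

lemma jacobsthal_squared_eq:
  assumes "\<chi> m = \<chi> n" "\<not> int p dvd n"
  shows "(jacobsthal m)\<^sup>2 = (jacobsthal n)\<^sup>2"
proof -
  have "\<chi> (m * n) = 1" using assms by (simp add: chi_mult chi_mult_self)
  then obtain k where k: "[k\<^sup>2 = m * n] (mod int p)" and nz: "\<not> int p dvd m * n"
    unfolding Legendre_def QuadRes_def by (auto simp: cong_0_iff split: if_splits)
  have "\<not> int p dvd k"
    using k nz by (metis cong_dvd_iff dvd_power2_p_iff)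
  moreover have "jacobsthal (n\<^sup>2 * m) = jacobsthal (k\<^sup>2 * n)"
  proof (rule class_funD[OF jacobsthal_class_fun])
    have "[k\<^sup>2 * n = m * n * n] (mod int p)"
      using k by (intro cong_mult cong_refl)
    then show "[n\<^sup>2 * m = k\<^sup>2 * n] (mod int p)"
      by (simp add: cong_sym_eq power2_eq_square mult_ac)
  qed
  ultimately have "\<chi> n * jacobsthal m = \<chi> k * jacobsthal n"
    using assms(2) by (simp add: jacobsthal_scale)
  then have "(\<chi> n * jacobsthal m)\<^sup>2 = (\<chi> k * jacobsthal n)\<^sup>2" by simp
  then show ?thesis
    using chi_mult_self[OF assms(2)] chi_mult_self[OF \<open>\<not> int p dvd k\<close>]
    by (simp add: power2_eq_square mult.assoc mult.left_commute[of _ "jacobsthal _"])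
       (metis mult.assoc mult_1)
qed

text \<open>
  The squares of the Jacobsthal sums take at most two values on nonzero arguments, one on the residues and one on
  the nonresidues. There are \<open>(p - 1) / 2\<close> of each kind, so the second moment determines their sum.
\<close>

lemma jacobsthal_two_squares:
  obtains g where "(jacobsthal 1)\<^sup>2 + (jacobsthal g)\<^sup>2 = 4 * int p"
proof -
  obtain g where g: "\<chi> g = - 1" by (rule obtain_nonresidue)
  have chi_1: "\<chi> 1 = 1" using chi_minus_1 chi_uminus[of 1] by simp
  define a where "a = (jacobsthal 1)\<^sup>2"
  define b where "b = (jacobsthal g)\<^sup>2"
  have summand: "2 * (jacobsthal n)\<^sup>2 = (1 + \<chi> n) * a + (1 - \<chi> n) * b - (if n = 0 then a + b else 0)"
    if "n \<in> \<F>" for n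
  proof (cases "n = 0")
    case True
    then show ?thesis using jacobsthal_0[of 0] chi_0_iff[of 0] by simp
  next
    case False
    then have "\<not> int p dvd n" using that dvd_residue_iff by blast
    then consider "\<chi> n = 1" | "\<chi> n = - 1" using chi_nonzero by blast
    then show ?thesis
    proof cases
      case 1
      then show ?thesis
        using False jacobsthal_squared_eq[of n 1] chi_1 not_dvd_1 by (simp add: a_def)
    next
      case 2
      then show ?thesis
        using False jacobsthal_squared_eq[of n g] g chi_0_iff[of g] by (simp add: b_def)
    qed
  qed
  have "2 * (\<Sum>n\<in>\<F>. (jacobsthal n)\<^sup>2) = (\<Sum>n\<in>\<F>. (a + b) + (a - b) * \<chi> n - (if n = 0 then a + b else 0))"
    unfolding sum_distrib_left by (intro sum.cong HOL.refl) (simp add: summand algebra_simps)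
  also have "\<dots> = int p * (a + b) - (a + b)"
    using p_pos by (simp add: sum.distrib sum_subtractf sum_distrib_left[symmetric] sum_chi)
  finally have "(int p - 1) * (a + b) = (int p - 1) * (4 * int p)"
    unfolding sum_jacobsthal_squared by (simp add: algebra_simps)
  then have "a + b = 4 * int p" using p_ge_5 by simp
  then show ?thesis using that a_def b_def by blast
qed

section \<open>Residue classes of Jacobsthal sums and representations as two squares\<close>

text \<open>
  Modulo \<open>p\<close> the square of \<open>1 + i\<close> is \<open>2 i\<close>.
\<close>

lemma chi_sqrt_minus_1:
  assumes i: "[i\<^sup>2 = - 1] (mod int p)"
  shows "\<chi> i = \<chi> 2"
proof -
  have "\<not> int p dvd 1 + i"
  proof
    assume "int p dvd 1 + i"
    then have "int p dvd (1 + i) * (i - 1)" by (rule dvd_mult2)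
    then have "int p dvd (i\<^sup>2 - (- 1)) - 2" by (simp add: power2_eq_square algebra_simps)
    moreover have "int p dvd i\<^sup>2 - (- 1)" using i by (simp only: cong_iff_dvd_diff)
    ultimately have "int p dvd 2" by (metis dvd_diffD dvd_diff_right_iff)
    then show False using not_dvd_2 by blast
  qed
  then have "\<chi> ((1 + i)\<^sup>2) = 1" by (rule chi_power2)
  moreover have "\<chi> ((1 + i)\<^sup>2) = \<chi> (2 * i)"
  proof (rule class_funD[OF chi_class_fun])
    have "(1 + i)\<^sup>2 - 2 * i = i\<^sup>2 - (- 1)" by (simp add: power2_eq_square algebra_simps)
    then show "[(1 + i)\<^sup>2 = 2 * i] (mod int p)" using i by (simp only: cong_iff_dvd_diff)
  qed
  ultimately have "\<chi> 2 * \<chi> i = 1" by (simp add: chi_mult)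
  then show ?thesis using chi_cases[of 2] chi_cases[of i] by auto
qed

lemma chi_2: "\<chi> 2 = (if p mod 8 = 1 then 1 else - 1)"
proof -
  obtain i where i: "[i\<^sup>2 = - 1] (mod int p)" by (rule obtain_sqrt_minus_1)
  have "\<chi> i = (- 1) ^ ((p - 1) div 4)"
  proof (rule sign_cong_imp_eq)
    have "(p - 1) div 2 = 2 * ((p - 1) div 4)" using p_mod_4 by presburger
    then have "[\<chi> i = (i\<^sup>2) ^ ((p - 1) div 4)] (mod int p)"
      using euler[of i] by (simp add: power_mult)
    then show "[\<chi> i = (- 1) ^ ((p - 1) div 4)] (mod int p)"
      using cong_pow[OF i] cong_trans by blast
    show "\<chi> i \<in> {0, 1, - 1}" using chi_cases[of i] by auto
  qed (simp add: minus_one_power_iff)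
  moreover have "even ((p - 1) div 4) \<longleftrightarrow> p mod 8 = 1"
  proof -
    obtain k where "p = 4 * k + 1" using p_mod_4 by (metis mod_div_decomp mult.commute)
    then show ?thesis by (cases "even k") (auto elim!: evenE oddE)
  qed
  ultimately show ?thesis using chi_sqrt_minus_1[OF i] by (simp add: minus_one_power_iff)
qed

text \<open>
  The substitutions \<open>t \<mapsto> - t\<close> and \<open>t \<mapsto> 1 / t\<close> preserve \<open>\<chi> (t (t\<^sup>2 + 1))\<close>. They and their composition fix
  only \<open>0\<close>, \<open>\<plusminus> 1\<close> and the square roots of \<open>-1\<close>; the summand is \<open>0\<close> at \<open>0\<close> and at these roots,
  and \<open>\<plusminus> 1\<close> are excluded. So the group generated by the two substitutions acts freely on the set counted.
\<close>

lemma card_jacobsthal_negative: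
  "4 dvd card {t \<in> \<F>. \<chi> t * \<chi> (t\<^sup>2 + 1) = - 1 \<and> \<not> [t\<^sup>2 = 1] (mod int p)}" (is "4 dvd card ?U")
proof -
  define neg where "neg t = (- t) mod int p" for t
  define recip where "recip t = modular_inverse (int p) t" for t
  have neg: "[neg t = - t] (mod int p)" "neg t \<in> \<F>" for t
    using p_pos by (auto simp: neg_def)
  have U_nz: "\<not> int p dvd t" "\<not> int p dvd t\<^sup>2 + 1" "t \<in> \<F>" "\<not> [t\<^sup>2 = 1] (mod int p)" if "t \<in> ?U" for t
    using that chi_0_iff[of t] chi_0_iff[of "t\<^sup>2 + 1"] by auto
  have recip: "[t * recip t = 1] (mod int p)" if "t \<in> ?U" for t
    using U_nz(1)[OF that] unfolding recip_def by (intro cong_modular_inverse1) (simp add: coprime_p_iff)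
  have recip_residue: "recip t \<in> \<F>" for t
    using p_pos by (simp add: recip_def modular_inverse_int_nonneg modular_inverse_int_less)
  have recip_unique: "recip t = u" if "u \<in> \<F>" "[t * u = 1] (mod int p)" for t u
    using that unfolding recip_def by (intro modular_inverse_int_eqI)
  have neg_U: "neg t \<in> ?U" if "t \<in> ?U" for t
  proof -
    have sq: "[(neg t)\<^sup>2 = t\<^sup>2] (mod int p)"
      using cong_pow[OF neg(1), of t 2] by simp
    have "\<chi> (neg t) = \<chi> t"
      using class_funD[OF chi_class_fun neg(1)] chi_uminus by simp
    moreover have "\<chi> ((neg t)\<^sup>2 + 1) = \<chi> (t\<^sup>2 + 1)"
      using sq by (intro class_funD[OF chi_class_fun] cong_add cong_refl)
    moreover have "\<not> [(neg t)\<^sup>2 = 1] (mod int p)"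
      using sq U_nz(4)[OF that] cong_trans cong_sym by blast
    ultimately show ?thesis using that neg(2) by simp
  qed
  have recip_U: "recip t \<in> ?U" if "t \<in> ?U" for t
  proof -
    have nz: "\<not> int p dvd t" using U_nz[OF that] by simp
    have sq: "[t\<^sup>2 * (recip t)\<^sup>2 = 1] (mod int p)"
      using cong_pow[OF recip[OF that], of 2] by (simp add: power_mult_distrib)
    have "\<chi> t * \<chi> (recip t) = \<chi> (1\<^sup>2)"
      unfolding chi_mult[symmetric] using recip[OF that] by (intro class_funD[OF chi_class_fun]) simp
    then have chi_recip: "\<chi> (recip t) = \<chi> t"
      using chi_power2[OF not_dvd_1] chi_nonzero[OF nz] by auto
    have "[t\<^sup>2 * (recip t)\<^sup>2 + t\<^sup>2 = 1 + t\<^sup>2] (mod int p)"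
      using sq by (intro cong_add cong_refl)
    then have "\<chi> (t\<^sup>2 * ((recip t)\<^sup>2 + 1)) = \<chi> (t\<^sup>2 + 1)"
      by (intro class_funD[OF chi_class_fun]) (simp add: algebra_simps)
    then have "\<chi> ((recip t)\<^sup>2 + 1) = \<chi> (t\<^sup>2 + 1)"
      using chi_power2[OF nz] by (simp add: chi_mult)
    moreover have "\<not> [(recip t)\<^sup>2 = 1] (mod int p)"
    proof
      assume "[(recip t)\<^sup>2 = 1] (mod int p)"
      then have "[t\<^sup>2 * (recip t)\<^sup>2 = t\<^sup>2 * 1] (mod int p)" by (intro cong_mult cong_refl)
      then show False using sq U_nz(4)[OF that] cong_trans cong_sym by (metis mult_1_right)
    qed
    ultimately show ?thesis using that recip_residue chi_recip by simp
  qed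
  show ?thesis
  proof (rule card_dvd_4_if_free_klein_four_action[where f = neg and g = recip])
    fix t assume t: "t \<in> ?U"
    note nz = U_nz[OF t]
    show "neg t \<in> ?U" "recip t \<in> ?U" using neg_U recip_U t by blast+
    have "[neg (neg t) = t] (mod int p)"
      using neg(1)[of "neg t"] neg(1)[of t] by (metis cong_minus_minus_iff cong_trans minus_minus)
    then show "neg (neg t) = t" using neg(2) nz(3) by (intro cong_residues_imp_eq)
    show "recip (recip t) = t"
      using recip[OF t] nz(3) by (intro recip_unique) (simp_all add: mult.commute)
    have "[neg t * neg (recip t) = (- t) * (- recip t)] (mod int p)"
      by (intro cong_mult neg)
    then have "[neg t * neg (recip t) = 1] (mod int p)"
      using recip[OF t] cong_trans by auto
    then have "recip (neg t) = neg (recip t)" by (intro recip_unique neg)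
    then show "neg (recip t) = recip (neg t)" by simp
    show "neg t \<noteq> t"
    proof
      assume "neg t = t"
      then have "int p dvd t - (- t)"
        using neg(1)[of t] by (simp only: cong_iff_dvd_diff)
      then have "int p dvd 2 * t" by simp
      then show False using nz(1) not_dvd_2 dvd_mult_p_iff by blast
    qed
    show "recip t \<noteq> t"
      using recip[OF t] nz(4) by (auto simp: power2_eq_square)
    show "neg (recip t) \<noteq> t"
    proof
      assume "neg (recip t) = t"
      then have "[t = - recip t] (mod int p)" using neg(1)[of "recip t"] by simp
      then have "[t * t = t * - recip t] (mod int p)" by (intro cong_mult cong_refl)
      moreover have "[t * - recip t = - 1] (mod int p)"
        using recip[OF t] by (simp add: cong_minus_minus_iff)
      ultimately have "[t\<^sup>2 = - 1] (mod int p)"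
        unfolding power2_eq_square by (rule cong_trans)
      then have "int p dvd t\<^sup>2 + 1" by (simp add: cong_iff_dvd_diff)
      then show False using nz(2) by blast
    qed
  qed (rule finite_subset[of _ \<F>], auto)
qed

text \<open>
  Three residues contribute \<open>0\<close>, the residues \<open>\<plusminus> 1\<close> contribute \<open>\<chi> 2\<close> each, and the remaining \<open>p - 5\<close> contribute
  \<open>1\<close> or \<open>-1\<close>. The number of the latter with value \<open>-1\<close> is divisible by \<open>4\<close>, so the sum is
  \<open>p - 5 + 2 \<chi> 2\<close> modulo \<open>8\<close>; the value of \<open>\<chi> 2\<close> depends on \<open>p\<close> modulo \<open>8\<close>.
\<close>

lemma jacobsthal_1_mod_8: "[jacobsthal 1 = - 2] (mod 8)"
proof -
  obtain i where i: "[i\<^sup>2 = - 1] (mod int p)" by (rule obtain_sqrt_minus_1)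
  define U where "U = {t \<in> \<F>. \<chi> t * \<chi> (t\<^sup>2 + 1) = - 1 \<and> \<not> [t\<^sup>2 = 1] (mod int p)}"
  have i_nz: "\<not> int p dvd i"
  proof
    assume "int p dvd i"
    then have "int p dvd - 1" using i by (metis cong_dvd_iff dvd_power2_p_iff)
    then show False using not_dvd_1 by simp
  qed
  have count: "(\<Sum>t\<in>\<F>. if [t\<^sup>2 = s\<^sup>2] (mod int p) then c else 0) = 2 * c" if "\<not> int p dvd s" for s and c :: int
    unfolding sum.inter_filter[OF finite_atLeastLessThan_int, symmetric]
    using sum_square_roots[OF class_fun_const that, of c] by simp
  have summand: "\<chi> t * \<chi> (t\<^sup>2 + 1) = 1 - 2 * (if t \<in> U then 1 else 0) - (if t = 0 then 1 else 0)
      - (if [t\<^sup>2 = i\<^sup>2] (mod int p) then 1 else 0) + (if [t\<^sup>2 = 1\<^sup>2] (mod int p) then \<chi> 2 - 1 else 0)"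
    if t: "t \<in> \<F>" for t
  proof -
    have root_i: "[t\<^sup>2 = i\<^sup>2] (mod int p) \<longleftrightarrow> int p dvd t\<^sup>2 + 1"
      using i by (metis cong_iff_dvd_diff cong_sym cong_trans diff_minus_eq_add)
    have zero: "int p dvd t \<longleftrightarrow> t = 0" by (rule dvd_residue_iff[OF t])
    consider "t = 0" | "[t\<^sup>2 = 1] (mod int p)" | "int p dvd t\<^sup>2 + 1"
      | "t \<noteq> 0" "\<not> [t\<^sup>2 = 1] (mod int p)" "\<not> int p dvd t\<^sup>2 + 1" by blast
    then show ?thesis
    proof cases
      case 1
      have "\<not> [0 = 1] (mod int p)" using not_dvd_1 by (simp add: cong_iff_dvd_diff)
      then show ?thesis
        using 1 root_i not_dvd_1 chi_0_iff[of 0] by (simp add: U_def)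
    next
      case 2
      have "\<not> int p dvd t" using 2 not_dvd_1 by (metis cong_dvd_iff dvd_power2_p_iff)
      moreover have "\<not> int p dvd t\<^sup>2 + 1"
      proof
        assume "int p dvd t\<^sup>2 + 1"
        moreover have "int p dvd t\<^sup>2 - 1" using 2 by (simp only: cong_iff_dvd_diff)
        ultimately have "int p dvd (t\<^sup>2 + 1) - (t\<^sup>2 - 1)" by (rule dvd_diff)
        then show False using not_dvd_2 by simp
      qed
      moreover have "\<chi> t = 1"
      proof -
        have "[t\<^sup>2 = 1\<^sup>2] (mod int p)" using 2 by simp
        then have "\<chi> t = \<chi> 1 \<or> \<chi> t = \<chi> (- 1)"
          unfolding square_cong_iff using class_funD[OF chi_class_fun] by blast
        then show ?thesis using chi_minus_1 chi_uminus[of 1] by auto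
      qed
      moreover have "\<chi> (t\<^sup>2 + 1) = \<chi> (1 + 1)"
        using 2 by (intro class_funD[OF chi_class_fun] cong_add cong_refl)
      ultimately show ?thesis using 2 zero root_i by (simp add: U_def)
    next
      case 3
      have "\<not> [t\<^sup>2 = 1] (mod int p)"
      proof
        assume "[t\<^sup>2 = 1] (mod int p)"
        then have "int p dvd t\<^sup>2 - 1" by (simp only: cong_iff_dvd_diff)
        with 3 have "int p dvd (t\<^sup>2 + 1) - (t\<^sup>2 - 1)" by (rule dvd_diff)
        then show False using not_dvd_2 by simp
      qed
      moreover have "t \<noteq> 0" using 3 not_dvd_1 by auto
      moreover have "\<chi> (t\<^sup>2 + 1) = 0" using 3 chi_0_iff by blast
      ultimately show ?thesis using 3 root_i by (simp add: U_def)
    next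
      case 4
      then have "\<chi> t = 1 \<or> \<chi> t = - 1" "\<chi> (t\<^sup>2 + 1) = 1 \<or> \<chi> (t\<^sup>2 + 1) = - 1"
        using chi_nonzero zero by blast+
      then show ?thesis using 4 root_i t by (auto simp: U_def)
    qed
  qed
  have "jacobsthal 1 = (\<Sum>t\<in>\<F>. 1 - 2 * (if t \<in> U then 1 else 0) - (if t = 0 then 1 else 0)
      - (if [t\<^sup>2 = i\<^sup>2] (mod int p) then 1 else 0) + (if [t\<^sup>2 = 1\<^sup>2] (mod int p) then \<chi> 2 - 1 else 0))"
    unfolding jacobsthal_def by (intro sum.cong HOL.refl summand)
  also have "\<dots> = int p - 2 * (\<Sum>t\<in>\<F>. if t \<in> U then 1 else 0) - 1 - 2 + 2 * (\<chi> 2 - 1)"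
    unfolding sum.distrib sum_subtractf sum_distrib_left[symmetric] count[OF i_nz] count[OF not_dvd_1]
    using p_pos by simp
  also have "(\<Sum>t\<in>\<F>. if t \<in> U then 1 else 0) = int (card U)"
  proof -
    have "\<F> \<inter> U = U" by (auto simp: U_def)
    then show ?thesis by (simp add: sum.If_cases)
  qed
  finally have expansion: "jacobsthal 1 = int p - 5 + 2 * \<chi> 2 - 2 * int (card U)" by simp
  obtain c where "card U = 4 * c" using card_jacobsthal_negative unfolding U_def by (auto elim: dvdE)
  with expansion have eq: "jacobsthal 1 - (- 2) = (int p - 3 + 2 * \<chi> 2) - 8 * int c" by simp
  have "8 dvd int p - 3 + 2 * \<chi> 2"
  proof (cases "p mod 8 = 1")
    case True
    have "8 dvd int p - 1" using True by presburger
    then show ?thesis using True chi_2 by simp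
  next
    case False
    then have "8 dvd int p - 5" using p_mod_4 by presburger
    then show ?thesis using False chi_2 by simp
  qed
  then have "8 dvd jacobsthal 1 - (- 2)" unfolding eq by (rule dvd_diff) simp
  then show ?thesis by (simp only: cong_iff_dvd_diff)
qed

text \<open>
  Uniqueness of the representation as a sum of two squares identifies half of the Jacobsthal sum with \<open>\<plusminus> a\<close>,
  and its residue modulo \<open>4\<close> decides the sign.
\<close>

lemma jacobsthal_1_eq:
  assumes "int p = a\<^sup>2 + b\<^sup>2" "[a = - \<chi> 2] (mod 4)"
  shows "jacobsthal 1 = 2 * \<chi> 2 * a"
proof -
  obtain g where g: "(jacobsthal 1)\<^sup>2 + (jacobsthal g)\<^sup>2 = 4 * int p" by (rule jacobsthal_two_squares)
  obtain c d where cd: "jacobsthal 1 = 2 * c" "jacobsthal g = 2 * d"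
    using even_jacobsthal by (meson evenE)
  have p_cd: "int p = c\<^sup>2 + d\<^sup>2" using g unfolding cd by (simp add: power_mult_distrib)
  have "8 dvd 2 * c - (- 2)" using jacobsthal_1_mod_8 unfolding cd cong_iff_dvd_diff .
  then have c: "4 dvd c + 1" by presburger
  have chi_2: "\<chi> 2 = 1 \<or> \<chi> 2 = - 1" using chi_nonzero[OF not_dvd_2] .
  have a: "4 dvd a + \<chi> 2" using assms(2) by (simp add: cong_iff_dvd_diff)
  have "odd c" "odd a" using c a chi_2 by (auto, presburger+)
  moreover have "odd (int p)" using p_mod_4 by presburger
  ultimately have "a\<^sup>2 = c\<^sup>2"
    using prime_two_squares_unique[OF prime_int_p assms(1) p_cd] by blast
  then have "c = a \<or> c = - a" by (metis power2_eq_iff)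
  then have "c = \<chi> 2 * a" using chi_2 a c by (auto, presburger+)
  then show ?thesis using cd by simp
qed

section \<open>The Gauss sum twisted by the Legendre symbol\<close>

definition twisted_sum :: complex where "twisted_sum = (\<Sum>x\<in>\<F>. of_int (\<chi> x) * e (x\<^sup>2))"

text \<open>
  In the double sum, \<open>y = x t\<close> turns the product of the two symbols into \<open>\<chi> t\<close> and the phase into \<open>(1 + t\<^sup>2) x\<^sup>2\<close>,
  so the sum over \<open>x\<close> is a quadratic Gauss sum. Its generic value \<open>\<chi> (1 + t\<^sup>2) sqrt p\<close> produces the Jacobsthal sum;
  the exceptional value \<open>p\<close> at the two square roots of \<open>-1\<close> produces the other summand.
\<close>

lemma twisted_sum_squared: "twisted_sum\<^sup>2 = 2 * of_int (\<chi> 2) * of_nat p + of_real (sqrt (real p)) * of_int (jacobsthal 1)"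
proof -
  have row: "(\<Sum>y\<in>\<F>. of_int (\<chi> x) * e (x\<^sup>2) * (of_int (\<chi> y) * e (y\<^sup>2)))
      = (\<Sum>t\<in>\<F>. of_int (\<chi> t) * (e ((1 + t\<^sup>2) * x\<^sup>2) - (if x = 0 then 1 else 0)))" if x: "x \<in> \<F>" for x
  proof (cases "x = 0")
    case True
    then show ?thesis using chi_0_iff[of 0] by simp
  next
    case False
    then have nz: "\<not> int p dvd x" using x dvd_residue_iff by blast
    have "(\<Sum>y\<in>\<F>. of_int (\<chi> x) * e (x\<^sup>2) * (of_int (\<chi> y) * e (y\<^sup>2)))
        = (\<Sum>t\<in>\<F>. of_int (\<chi> x) * e (x\<^sup>2) * (of_int (\<chi> (x * t)) * e ((x * t)\<^sup>2)))"
      by (rule sum_scale[where f = "\<lambda>y. of_int (\<chi> x) * e (x\<^sup>2) * (of_int (\<chi> y) * e (y\<^sup>2))", OF _ nz, symmetric])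
         (rule class_fun_intros | assumption)+
    also have "\<dots> = (\<Sum>t\<in>\<F>. of_int (\<chi> x * \<chi> x) * (of_int (\<chi> t) * (e (x\<^sup>2) * e ((x * t)\<^sup>2))))"
      by (simp add: chi_mult mult_ac)
    also have "\<dots> = (\<Sum>t\<in>\<F>. of_int (\<chi> t) * e ((1 + t\<^sup>2) * x\<^sup>2))"
      unfolding chi_mult_self[OF nz] e_add[symmetric] by (simp add: power_mult_distrib algebra_simps)
    finally show ?thesis using False by simp
  qed
  have inner: "(\<Sum>x\<in>\<F>. e ((1 + t\<^sup>2) * x\<^sup>2) - (if x = 0 then 1 else 0)) = gauss (1 + t\<^sup>2) - 1" for t
    using p_pos by (simp add: sum_subtractf gauss_def)
  obtain i where i: "[i\<^sup>2 = - 1] (mod int p)" by (rule obtain_sqrt_minus_1)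
  have i_nz: "\<not> int p dvd i"
    using chi_sqrt_minus_1[OF i] chi_0_iff[of i] chi_0_iff[of 2] not_dvd_2 by auto
  have gauss: "gauss (1 + t\<^sup>2) = of_int (\<chi> (t\<^sup>2 + 1)) * of_real (sqrt (real p))
      + (if [t\<^sup>2 = i\<^sup>2] (mod int p) then of_nat p else 0)" for t
  proof -
    have "[t\<^sup>2 = i\<^sup>2] (mod int p) \<longleftrightarrow> int p dvd t\<^sup>2 + 1"
      using i by (metis cong_iff_dvd_diff cong_sym cong_trans diff_minus_eq_add)
    then show ?thesis
      using gauss_dvd[of "1 + t\<^sup>2"] gauss_eq_chi[of "1 + t\<^sup>2"] gauss_sum_value chi_0_iff[of "t\<^sup>2 + 1"]
      by (simp add: add.commute)
  qed
  have "twisted_sum\<^sup>2 = (\<Sum>x\<in>\<F>. \<Sum>y\<in>\<F>. of_int (\<chi> x) * e (x\<^sup>2) * (of_int (\<chi> y) * e (y\<^sup>2)))"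
    by (simp add: twisted_sum_def power2_eq_square sum_product)
  also have "\<dots> = (\<Sum>x\<in>\<F>. \<Sum>t\<in>\<F>. of_int (\<chi> t) * (e ((1 + t\<^sup>2) * x\<^sup>2) - (if x = 0 then 1 else 0)))"
    by (intro sum.cong HOL.refl row)
  also have "\<dots> = (\<Sum>t\<in>\<F>. of_int (\<chi> t) * (gauss (1 + t\<^sup>2) - 1))"
    by (subst sum.swap) (simp only: sum_distrib_left[symmetric] inner)
  also have "\<dots> = (\<Sum>t\<in>\<F>. of_real (sqrt (real p)) * of_int (\<chi> t * \<chi> (t\<^sup>2 + 1))
      + of_nat p * of_int (if [t\<^sup>2 = i\<^sup>2] (mod int p) then \<chi> t else 0) - of_int (\<chi> t))"
    unfolding gauss by (intro sum.cong HOL.refl) (simp add: algebra_simps)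
  also have "\<dots> = of_real (sqrt (real p)) * of_int (jacobsthal 1)
      + of_nat p * of_int (\<Sum>t\<in>\<F>. if [t\<^sup>2 = i\<^sup>2] (mod int p) then \<chi> t else 0) - of_int (\<Sum>t\<in>\<F>. \<chi> t)"
    unfolding jacobsthal_def of_int_sum sum.distrib sum_subtractf sum_distrib_left ..
  also have "(\<Sum>t\<in>\<F>. if [t\<^sup>2 = i\<^sup>2] (mod int p) then \<chi> t else 0) = 2 * \<chi> 2"
    unfolding sum.inter_filter[OF finite_atLeastLessThan_int, symmetric]
    using sum_square_roots[OF chi_class_fun i_nz] chi_sqrt_minus_1[OF i] by (simp add: chi_uminus)
  finally show ?thesis by (simp add: sum_chi)
qed

end

theorem theorem1:
  fixes p :: nat and a4 b4 \<mu> :: int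
  assumes "prime p" and "odd p"
    and "int p = a4\<^sup>2 + b4\<^sup>2"
    and "\<mu> \<in> {1, -1}"
    and "[\<mu> = 2 ^ ((p - 1) div 2)] (mod int p)"
    and "[a4 = - \<mu>] (mod 4)"
  defines "S \<equiv> \<Sum>x = 0..p - 1. complex_of_int (Legendre (int x) (int p)) *
                   exp (\<i> * 2 * complex_of_real pi * (of_nat x)\<^sup>2 / of_nat p)"
    and "R \<equiv> csqrt (complex_of_real (2 * real_of_int \<mu> * (real p + real_of_int a4 * sqrt (real p))))"
  shows "S = R \<or> S = - R"
proof -
  have p_mod_4: "p mod 4 = 1"
  proof -
    have "int p mod 4 = ((a4 mod 4)\<^sup>2 + (b4 mod 4)\<^sup>2) mod 4"
      unfolding assms(3) by (intro mod_add_cong power_mod[symmetric])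
    moreover have "a4 mod 4 = 0 \<or> a4 mod 4 = 1 \<or> a4 mod 4 = 2 \<or> a4 mod 4 = 3"
      "b4 mod 4 = 0 \<or> b4 mod 4 = 1 \<or> b4 mod 4 = 2 \<or> b4 mod 4 = 3" by presburger+
    ultimately have "int p mod 4 \<noteq> 3" by (elim disjE) simp_all
    then show ?thesis using assms(2) by presburger
  qed
  interpret prime_1_mod_4 p
    by unfold_locales (use assms(1) p_mod_4 in auto)
  have \<mu>: "\<mu> = \<chi> 2"
    using assms(4) chi_cases[of 2] cong_trans[OF assms(5) cong_sym[OF euler[of 2]]]
    by (intro sign_cong_imp_eq) auto
  have "S = (\<Sum>x\<in>\<F>. of_int (\<chi> x) * e (x\<^sup>2))"
    unfolding S_def
  proof (rule sum.reindex_bij_witness[of _ nat int])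
    fix x
    have "exp (\<i> * 2 * complex_of_real pi * (of_nat x)\<^sup>2 / of_nat p) = e ((int x)\<^sup>2)"
      unfolding e_def cis_conv_exp by (simp add: mult_ac)
    then show "of_int (\<chi> (int x)) * e ((int x)\<^sup>2) = complex_of_int (\<chi> (int x)) *
        exp (\<i> * 2 * complex_of_real pi * (of_nat x)\<^sup>2 / of_nat p)" by simp
  qed (use p_ge_5 in auto)
  then have "S = twisted_sum"
    by (simp only: twisted_sum_def)
  then have "S\<^sup>2 = 2 * of_int \<mu> * of_nat p + of_real (sqrt (real p)) * of_int (2 * \<mu> * a4)"
    using twisted_sum_squared jacobsthal_1_eq[OF assms(3)] assms(6) \<mu> by simp
  also have "\<dots> = R\<^sup>2"
    by (simp add: R_def algebra_simps)
  finally show ?thesis by (simp add: power2_eq_iff)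
qed

end
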